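(* Assume the Continuum Hypothesis. Let $\rho_i:\mathcal{F}_i\to[\Lambda_i]^\omega$ be partition regular functions for $i=1,2$. If $\rho_1$ is weak $P^+$ and has small accretions, then the following conditions are equivalent: (1) $\rho_2\not\leq_K\rho_1$. (2) There exists a separable topological space $X$ with unique limits of sequences such that $X\in\mathrm{FinBW}(\rho_1)\setminus\mathrm{FinBW}(\rho_2)$.
   Context: Topological spaces are not assumed Hausdorff. $[A]^\omega$ is the family of infinite countable subsets of $A$, $[A]^{<\omega}$ the family of finite subsets of $A$. Partition regular functions: let $\Lambda,\Omega$ be countably infinite, and let $\mathcal{F}$ be a nonempty family of infinite subsets of $\Omega$ such that $F\setminus K\in\mathcal{F}$ for all $F\in\mathcal{F}$ and finite $K\subseteq\Omega$. A function $\rho:\mathcal{F}\to[\Lambda]^\omega$ is partition regular if (M) for all $E,F\in\mathcal{F}$, $E\subseteq F$ implies $\rho(E)\subseteq\rho(F)$; (R) for all $F\in\mathcal{F}$ and $A,B\subseteq\Lambda$ with $\rho(F)=A\cup B$ there is $E\in\mathcal{F}$ with $\rho(E)\subseteq A$ or $\rho(E)\subseteq B$; (S) for every $F\in\mathcal{F}$ there is $E\in\mathcal{F}$ with $E\subseteq F$ such that for every $a\in\rho(E)$ there is a finite $K\subseteq\Omega$ with $a\notin\rho(E\setminus K)$. Put $\mathcal{I}_\rho=\{A\subseteq\Lambda:\forall F\in\mathcal{F}\ \rho(F)\not\subseteq A\}$ (an ideal on $\Lambda$). For $F\in\mathcal{F}$ and $B\subseteq\Lambda$ write $\rho(F)\subseteq^\rho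 B$ if there is a finite $K\subseteq\Omega$ with $\rho(F\setminus K)\subseteq B$. $\rho$ is weak $P^+$ if for every $E\in\mathcal{F}$ there is $F\in\mathcal{F}$ with $\rho(F)\subseteq\rho(E)$ such that for every sequence $(F_n)_{n\in\omega}$ in $\mathcal{F}$ with $\rho(F)\supseteq\rho(F_n)\supseteq\rho(F_{n+1})$ for all $n$ there is $G\in\mathcal{F}$ with $\rho(G)\subseteq^\rho\rho(F_n)$ for all $n$. $F\in\mathcal{F}$ has small accretions if $\rho(F)\setminus\rho(F\setminus K)\in\mathcal{I}_\rho$ for every finite $K\subseteq\Omega$; $\rho$ has small accretions if every $E\in\mathcal{F}$ contains some $F\in\mathcal{F}$, $F\subseteq E$, with small accretions. Katětov order for partition regular $\rho_i:\mathcal{F}_i\to[\Lambda_i]^\omega$, $\mathcal{F}_i\subseteq[\Omega_i]^\omega$: $\rho_2\leq_K\rho_1$ if there is $\phi:\Lambda_1\to\Lambda_2$ such that $\forall F_1\in\mathcal{F}_1\,\exists F_2\in\mathcal{F}_2\,\forall K_1\in[\Omega_1]^{<\omega}\,\exists K_2\in[\Omega_2]^{<\omega}\ \rho_2(F_2\setminus K_2)\subseteq\phi[\rho_1(F_1\setminus K_1)]$. For $F\in\mathcal{F}$, $f:\rho(F)\to X$ is $\rho$-convergent to $x\in X$ if for every neighbourhood $U$ of $x$ there is a finite $K\subseteq\Omega$ with $f[\rho(F\setminus K)]\subseteq U$. $\mathrm{FinBW}(\rho)$ is the class of all topological spaces $X$ such that for every $f:\Lambda\to X$ there is $F\in\mathcal{F}$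 such that $f\restriction\rho(F)$ is $\rho$-convergent to some point of $X$. *)

theory Defs
  imports "HOL-Analysis.Analysis"
begin

definition continuum_hypothesis :: bool where
  "continuum_hypothesis \<longleftrightarrow>
     (\<forall>S :: real set. countable S \<or> S \<approx> (UNIV :: real set))"

text \<open>
  The map \<open>\<rho>\<close> is a total function on subsets of the type \<open>'o\<close>; only its values on the family
  \<open>\<F>\<close> are relevant, and all conditions below are restricted to members of \<open>\<F>\<close>.
  Members of \<open>\<F>\<close> and their images are automatically countable, being subsets of \<open>\<Omega>\<close> and \<open>\<Lambda>\<close>.
\<close>

definition partition_regular ::
  "'l set \<Rightarrow> 'o set \<Rightarrow> 'o set set \<Rightarrow> ('o set \<Rightarrow> 'l set) \<Rightarrow> bool" where
  "partition_regular \<Lambda> \<Omega> \<F> \<rho> \<longleftrightarrow>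
     countable \<Lambda> \<and> infinite \<Lambda> \<and> countable \<Omega> \<and> infinite \<Omega> \<and>
     \<F> \<noteq> {} \<and>
     (\<forall>F\<in>\<F>. F \<subseteq> \<Omega> \<and> infinite F) \<and>
     (\<forall>F\<in>\<F>. \<forall>K. K \<subseteq> \<Omega> \<and> finite K \<longrightarrow> F - K \<in> \<F>) \<and>
     (\<forall>F\<in>\<F>. \<rho> F \<subseteq> \<Lambda> \<and> infinite (\<rho> F)) \<and>
     (\<forall>E\<in>\<F>. \<forall>F\<in>\<F>. E \<subseteq> F \<longrightarrow> \<rho> E \<subseteq> \<rho> F) \<and>
     (\<forall>F\<in>\<F>. \<forall>A B. A \<subseteq> \<Lambda> \<and> B \<subseteq> \<Lambda> \<and> \<rho> F = A \<union> B \<longrightarrow>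
        (\<exists>E\<in>\<F>. \<rho> E \<subseteq> A \<or> \<rho> E \<subseteq> B)) \<and>
     (\<forall>F\<in>\<F>. \<exists>E\<in>\<F>. E \<subseteq> F \<and>
        (\<forall>a\<in>\<rho> E. \<exists>K. K \<subseteq> \<Omega> \<and> finite K \<and> a \<notin> \<rho> (E - K)))"

definition ideal_of ::
  "'l set \<Rightarrow> 'o set set \<Rightarrow> ('o set \<Rightarrow> 'l set) \<Rightarrow> 'l set set" where
  "ideal_of \<Lambda> \<F> \<rho> = {A. A \<subseteq> \<Lambda> \<and> (\<forall>F\<in>\<F>. \<not> \<rho> F \<subseteq> A)}"

definition almost_subset ::
  "'o set \<Rightarrow> ('o set \<Rightarrow> 'l set) \<Rightarrow> 'o set \<Rightarrow> 'l set \<Rightarrow> bool" where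
  "almost_subset \<Omega> \<rho> F B \<longleftrightarrow> (\<exists>K. K \<subseteq> \<Omega> \<and> finite K \<and> \<rho> (F - K) \<subseteq> B)"

definition weak_P_plus ::
  "'o set \<Rightarrow> 'o set set \<Rightarrow> ('o set \<Rightarrow> 'l set) \<Rightarrow> bool" where
  "weak_P_plus \<Omega> \<F> \<rho> \<longleftrightarrow>
     (\<forall>E\<in>\<F>. \<exists>F\<in>\<F>. \<rho> F \<subseteq> \<rho> E \<and>
        (\<forall>S :: nat \<Rightarrow> 'o set.
           (\<forall>n. S n \<in> \<F> \<and> \<rho> (S n) \<subseteq> \<rho> F \<and> \<rho> (S (Suc n)) \<subseteq> \<rho> (S n)) \<longrightarrow>
           (\<exists>G\<in>\<F>. \<forall>n. almost_subset \<Omega> \<rho> G (\<rho> (S n)))))"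

definition set_has_small_accretions ::
  "'l set \<Rightarrow> 'o set \<Rightarrow> 'o set set \<Rightarrow> ('o set \<Rightarrow> 'l set) \<Rightarrow> 'o set \<Rightarrow> bool" where
  "set_has_small_accretions \<Lambda> \<Omega> \<F> \<rho> F \<longleftrightarrow>
     (\<forall>K. K \<subseteq> \<Omega> \<and> finite K \<longrightarrow> \<rho> F - \<rho> (F - K) \<in> ideal_of \<Lambda> \<F> \<rho>)"

definition has_small_accretions ::
  "'l set \<Rightarrow> 'o set \<Rightarrow> 'o set set \<Rightarrow> ('o set \<Rightarrow> 'l set) \<Rightarrow> bool" where
  "has_small_accretions \<Lambda> \<Omega> \<F> \<rho> \<longleftrightarrow>
     (\<forall>E\<in>\<F>. \<exists>F\<in>\<F>. F \<subseteq> E \<and> set_has_small_accretions \<Lambda> \<Omega> \<F> \<rho> F)"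

text \<open>The first group of arguments is the smaller function: \<open>\<rho>\<^sub>2 \<le>\<^sub>K \<rho>\<^sub>1\<close>.\<close>

definition katetov_le ::
  "'l2 set \<Rightarrow> 'o2 set \<Rightarrow> 'o2 set set \<Rightarrow> ('o2 set \<Rightarrow> 'l2 set) \<Rightarrow>
   'l1 set \<Rightarrow> 'o1 set \<Rightarrow> 'o1 set set \<Rightarrow> ('o1 set \<Rightarrow> 'l1 set) \<Rightarrow> bool" where
  "katetov_le \<Lambda>\<^sub>2 \<Omega>\<^sub>2 \<F>\<^sub>2 \<rho>\<^sub>2 \<Lambda>\<^sub>1 \<Omega>\<^sub>1 \<F>\<^sub>1 \<rho>\<^sub>1 \<longleftrightarrow>
     (\<exists>\<phi> \<in> \<Lambda>\<^sub>1 \<rightarrow> \<Lambda>\<^sub>2. \<forall>F\<^sub>1\<in>\<F>\<^sub>1. \<exists>F\<^sub>2\<in>\<F>\<^sub>2.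
        \<forall>K\<^sub>1. K\<^sub>1 \<subseteq> \<Omega>\<^sub>1 \<and> finite K\<^sub>1 \<longrightarrow>
          (\<exists>K\<^sub>2. K\<^sub>2 \<subseteq> \<Omega>\<^sub>2 \<and> finite K\<^sub>2 \<and> \<rho>\<^sub>2 (F\<^sub>2 - K\<^sub>2) \<subseteq> \<phi> ` \<rho>\<^sub>1 (F\<^sub>1 - K\<^sub>1)))"

definition rho_convergent ::
  "'o set \<Rightarrow> ('o set \<Rightarrow> 'l set) \<Rightarrow> 'o set \<Rightarrow> 'x topology \<Rightarrow> ('l \<Rightarrow> 'x) \<Rightarrow> 'x \<Rightarrow> bool" where
  "rho_convergent \<Omega> \<rho> F X f x \<longleftrightarrow>
     x \<in> topspace X \<and>
     (\<forall>U. openin X U \<and> x \<in> U \<longrightarrow>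
        (\<exists>K. K \<subseteq> \<Omega> \<and> finite K \<and> f ` \<rho> (F - K) \<subseteq> U))"

definition FinBW ::
  "'l set \<Rightarrow> 'o set \<Rightarrow> 'o set set \<Rightarrow> ('o set \<Rightarrow> 'l set) \<Rightarrow> 'x topology set" where
  "FinBW \<Lambda> \<Omega> \<F> \<rho> =
     {X. \<forall>f \<in> \<Lambda> \<rightarrow> topspace X. \<exists>F\<in>\<F>. \<exists>x. rho_convergent \<Omega> \<rho> F X f x}"

definition unique_sequential_limits :: "'x topology \<Rightarrow> bool" where
  "unique_sequential_limits X \<longleftrightarrow>
     (\<forall>(s :: nat \<Rightarrow> 'x) a b. range s \<subseteq> topspace X \<and>
        limitin X s a sequentially \<and> limitin X s b sequentially \<longrightarrow> a = b)"

end

theory Submission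
  imports Defs
begin

text \<open>
  If \<open>\<phi>\<close> witnesses \<open>\<rho>\<^sub>2 \<le>\<^sub>K \<rho>\<^sub>1\<close>, then a \<open>\<rho>\<^sub>1\<close>-convergent restriction of \<open>f \<circ> \<phi>\<close> yields a
  \<open>\<rho>\<^sub>2\<close>-convergent restriction of \<open>f\<close>, so \<open>FinBW(\<rho>\<^sub>1) \<subseteq> FinBW(\<rho>\<^sub>2)\<close>.

  Conversely, the space consists of \<open>\<Lambda>\<^sub>2\<close> (isolated points), at most continuum many further points,
  and one point at infinity. By CH the maps \<open>h : \<Lambda>\<^sub>1 \<rightarrow> \<Lambda>\<^sub>2\<close> (partial maps, in fact) are enumerated in
  a well-order with countable initial segments. If \<open>h\<close> is not already constant or convergent to
  an earlier point along some \<open>F\<close>, a new point is added whose basic neighbourhoods are the images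
  \<open>h[\<rho>\<^sub>1(G - K)]\<close>. Starting from the set \<open>E\<close> at which \<open>h\<close> fails to be a Katetov reduction, small
  accretions allow one to thin out into every \<open>\<rho>\<^sub>1(E - K)\<close>, and weak \<open>P\<^sup>+\<close> yields a single \<open>G\<close>
  meeting countably many demands: staying inside every \<open>\<rho>\<^sub>1(E - K)\<close> (so the identity of \<open>\<Lambda>\<^sub>2\<close> does
  not \<open>\<rho>\<^sub>2\<close>-converge to the new point), leaving every finite set, and separating the new point from
  the earlier ones. Finite-to-one maps into the set of added points converge to infinity. Removing
  an added point together with a sequence of \<open>\<Lambda>\<^sub>2\<close> converging to it leaves a neighbourhood of
  infinity; this gives unique sequential limits, although the space need not be Hausdorff. It also
  prevents \<open>\<rho>\<^sub>2\<close>-convergence to infinity, because every infinite subset of \<open>\<Lambda>\<^sub>2\<close> contains a sequence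
  converging to an added point.
\<close>

section \<open>Tail sequences\<close>

text \<open>Sequences stand for the filters they generate. With \<open>t\<close> a neighbourhood
  base at a point this relation is convergence; with \<open>t n\<close> the terms of a decreasing
  sequence of values of \<open>\<rho>\<close> it is the almost inclusion of weak
  \<open>P\<^sup>+\<close>.\<close>

definition tail_refines :: "(nat \<Rightarrow> 'a set) \<Rightarrow> (nat \<Rightarrow> 'a set) \<Rightarrow> bool" where
  "tail_refines s t \<longleftrightarrow> (\<forall>n. \<exists>m. s m \<subseteq> t n)"

text \<open>Initial segments of an enumeration of \<open>\<Omega>\<close> are cofinal among its
  finite subsets, so one index \<open>n\<close> can replace the quantifier over finite sets
  \<open>K\<close>.\<close>

definition tail :: "'o set \<Rightarrow> ('o set \<Rightarrow> 'l set) \<Rightarrow> 'o set \<Rightarrow> nat \<Rightarrow> 'l set" where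
  "tail \<Omega> \<rho> F n = \<rho> (F - from_nat_into \<Omega> ` {..<n})"

text \<open>Distils partition regularity into properties of tail sequences, so that the construction
  need not mention \<open>\<Omega>\<close>, \<open>\<F>\<close> or \<open>\<rho>\<close>. A member
  \<open>t\<close> stands for some \<open>F\<close>, and \<open>t 0\<close> for the value
  \<open>\<rho> F\<close>.\<close>

locale tail_family =
  fixes L :: "'l set" and T :: "(nat \<Rightarrow> 'l set) set"
  assumes countable_base: "countable L"
    and infinite_base: "infinite L"
    and tail_antimono: "t \<in> T \<Longrightarrow> m \<le> n \<Longrightarrow> t n \<subseteq> t m"
    and infinite_tail: "t \<in> T \<Longrightarrow> infinite (t n)"
    and tail_subset: "t \<in> T \<Longrightarrow> t n \<subseteq> L"
    and tail_split: "t \<in> T \<Longrightarrow> t 0 \<subseteq> A \<union> B \<Longrightarrow> \<exists>s\<in>T. s 0 \<subseteq> t 0 \<inter> A \<or> s 0 \<subseteq> t 0 \<inter> B"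
    and tail_shift: "t \<in> T \<Longrightarrow> \<exists>s\<in>T. s 0 \<subseteq> t m \<and> tail_refines s t"

text \<open>The last condition of \<open>small_accretions\<close> expresses that each
  \<open>s 0 - s n\<close> belongs to the ideal.\<close>

locale diagonal_tail_family = tail_family +
  assumes weak_P: "t \<in> T \<Longrightarrow> \<exists>s\<in>T. s 0 \<subseteq> t 0 \<and>
      (\<forall>S. (\<forall>n. S n \<in> T \<and> S n 0 \<subseteq> s 0 \<and> S (Suc n) 0 \<subseteq> S n 0) \<longrightarrow>
        (\<exists>u\<in>T. tail_refines u (\<lambda>n. S n 0)))"
    and small_accretions: "t \<in> T \<Longrightarrow> \<exists>s\<in>T. (\<forall>n. s n \<subseteq> t n) \<and>
      (\<forall>n. \<forall>u\<in>T. \<not> u 0 \<subseteq> s 0 - s n)"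

lemma finite_subset_initial_segment:
  assumes "countable \<Omega>" "finite K" "K \<subseteq> \<Omega>"
  shows "\<exists>n. K \<subseteq> from_nat_into \<Omega> ` {..<n}"
proof (cases "K = {}")
  case False
  then have "K \<subseteq> range (from_nat_into \<Omega>)"
    using assms by (metis range_from_nat_into subset_empty)
  then obtain J where J: "finite J" "K = from_nat_into \<Omega> ` J"
    using assms(2) by (meson finite_subset_image)
  then obtain n where "J \<subseteq> {..<n}"
    using finite_nat_bounded by blast
  with J show ?thesis by blast
qed simp

section \<open>From partition regular functions to tail families\<close>

context
  fixes \<Lambda> :: "'l set" and \<Omega> :: "'o set" and \<F> :: "'o set set" and \<rho> :: "'o set \<Rightarrow> 'l set"
  assumes pr: "partition_regular \<Lambda> \<Omega> \<F> \<rho>"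
begin

lemma countable_universe: "countable \<Omega>"
  using pr unfolding partition_regular_def by (elim conjE)

lemma rho_mono:
  assumes "E \<in> \<F>" "F \<in> \<F>" "E \<subseteq> F"
  shows "\<rho> E \<subseteq> \<rho> F"
proof -
  have "\<forall>E\<in>\<F>. \<forall>F\<in>\<F>. E \<subseteq> F \<longrightarrow> \<rho> E \<subseteq> \<rho> F"
    using pr unfolding partition_regular_def by (elim conjE)
  with assms show ?thesis by blast
qed

lemma rho_subset_infinite:
  assumes "F \<in> \<F>"
  shows "\<rho> F \<subseteq> \<Lambda>" "infinite (\<rho> F)"
proof -
  have "\<forall>F\<in>\<F>. \<rho> F \<subseteq> \<Lambda> \<and> infinite (\<rho> F)"
    using pr unfolding partition_regular_def by (elim conjE)
  with assms show "\<rho> F \<subseteq> \<Lambda>" "infinite (\<rho> F)" by blast+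
qed

lemma diff_finite:
  assumes "F \<in> \<F>" "K \<subseteq> \<Omega>" "finite K"
  shows "F - K \<in> \<F>"
proof -
  have "\<forall>F\<in>\<F>. \<forall>K. K \<subseteq> \<Omega> \<and> finite K \<longrightarrow> F - K \<in> \<F>"
    using pr unfolding partition_regular_def by (elim conjE)
  with assms show ?thesis by blast
qed

lemma initial_segment_subset: "from_nat_into \<Omega> ` {..<n} \<subseteq> \<Omega>"
proof -
  have "infinite \<Omega>" using pr unfolding partition_regular_def by (elim conjE)
  then have "\<Omega> \<noteq> {}" by auto
  then show ?thesis by (simp add: image_subset_iff from_nat_into)
qed

lemma diff_initial_segment: "F \<in> \<F> \<Longrightarrow> F - from_nat_into \<Omega> ` {..<n} \<in> \<F>"
  by (simp add: diff_finite initial_segment_subset)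

lemma finite_diff_iff_tail:
  assumes "F \<in> \<F>"
  shows "(\<exists>K. K \<subseteq> \<Omega> \<and> finite K \<and> \<rho> (F - K) \<subseteq> B) \<longleftrightarrow> (\<exists>n. tail \<Omega> \<rho> F n \<subseteq> B)"
proof
  assume "\<exists>K. K \<subseteq> \<Omega> \<and> finite K \<and> \<rho> (F - K) \<subseteq> B"
  then obtain K where K: "K \<subseteq> \<Omega>" "finite K" "\<rho> (F - K) \<subseteq> B" by blast
  then obtain n where n: "K \<subseteq> from_nat_into \<Omega> ` {..<n}"
    using finite_subset_initial_segment[OF countable_universe] by metis
  have "F - K \<in> \<F>"
    using diff_finite[OF assms K(1,2)] .
  moreover have "F - from_nat_into \<Omega> ` {..<n} \<subseteq> F - K"
    using n by blast
  ultimately have "tail \<Omega> \<rho> F n \<subseteq> \<rho> (F - K)"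
    unfolding tail_def using rho_mono[OF diff_initial_segment[OF assms, of n]] by simp
  with K show "\<exists>n. tail \<Omega> \<rho> F n \<subseteq> B" by blast
next
  assume "\<exists>n. tail \<Omega> \<rho> F n \<subseteq> B"
  then show "\<exists>K. K \<subseteq> \<Omega> \<and> finite K \<and> \<rho> (F - K) \<subseteq> B"
    using initial_segment_subset unfolding tail_def by blast
qed

lemma tail_0: "tail \<Omega> \<rho> F 0 = \<rho> F"
  by (simp add: tail_def)

lemma tail_mono:
  assumes "E \<in> \<F>" "F \<in> \<F>" "E \<subseteq> F"
  shows "tail \<Omega> \<rho> E n \<subseteq> tail \<Omega> \<rho> F n"
  unfolding tail_def using assms by (intro rho_mono diff_initial_segment) auto

lemma tail_family_tails: "tail_family \<Lambda> (tail \<Omega> \<rho> ` \<F>)"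
proof
  show "countable \<Lambda>" "infinite \<Lambda>"
    using pr unfolding partition_regular_def by simp_all
next
  fix t and m n :: nat assume "t \<in> tail \<Omega> \<rho> ` \<F>" "m \<le> n"
  then obtain F where F: "F \<in> \<F>" "t = tail \<Omega> \<rho> F" by blast
  have "F - from_nat_into \<Omega> ` {..<n} \<subseteq> F - from_nat_into \<Omega> ` {..<m}"
    using \<open>m \<le> n\<close> by force
  then show "t n \<subseteq> t m"
    unfolding F tail_def using F(1) by (intro rho_mono diff_initial_segment)
next
  fix t n assume "t \<in> tail \<Omega> \<rho> ` \<F>"
  then show "infinite (t n)" "t n \<subseteq> \<Lambda>"
    using rho_subset_infinite[OF diff_initial_segment] by (force simp: tail_def)+
next
  fix t A B assume "t \<in> tail \<Omega> \<rho> ` \<F>" "t 0 \<subseteq> A \<union> B"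
  then obtain F where F: "F \<in> \<F>" "t = tail \<Omega> \<rho> F" by blast
  have "\<rho> F = \<rho> F \<inter> A \<union> \<rho> F \<inter> B"
    using F \<open>t 0 \<subseteq> A \<union> B\<close> tail_0 by blast
  moreover have "\<rho> F \<inter> A \<subseteq> \<Lambda>" "\<rho> F \<inter> B \<subseteq> \<Lambda>"
    using rho_subset_infinite(1)[OF F(1)] by blast+
  moreover have "\<forall>F\<in>\<F>. \<forall>A B. A \<subseteq> \<Lambda> \<and> B \<subseteq> \<Lambda> \<and> \<rho> F = A \<union> B \<longrightarrow>
        (\<exists>E\<in>\<F>. \<rho> E \<subseteq> A \<or> \<rho> E \<subseteq> B)"
    using pr unfolding partition_regular_def by (elim conjE)
  ultimately have "\<exists>E\<in>\<F>. \<rho> E \<subseteq> \<rho> F \<inter> A \<or> \<rho> E \<subseteq> \<rho> F \<inter> B"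
    using F(1) by meson
  then show "\<exists>s\<in>tail \<Omega> \<rho> ` \<F>. s 0 \<subseteq> t 0 \<inter> A \<or> s 0 \<subseteq> t 0 \<inter> B"
    using F by (auto simp: tail_0)
next
  fix t m assume "t \<in> tail \<Omega> \<rho> ` \<F>"
  then obtain F where F: "F \<in> \<F>" "t = tail \<Omega> \<rho> F" by blast
  let ?G = "F - from_nat_into \<Omega> ` {..<m}"
  have "?G \<in> \<F>" using F diff_initial_segment by blast
  moreover have "tail \<Omega> \<rho> ?G 0 = t m" by (simp add: F tail_def)
  moreover have "tail_refines (tail \<Omega> \<rho> ?G) t"
    using tail_mono[OF \<open>?G \<in> \<F>\<close> F(1)] F(2) unfolding tail_refines_def by blast
  ultimately show "\<exists>s\<in>tail \<Omega> \<rho> ` \<F>. s 0 \<subseteq> t m \<and> tail_refines s t"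
    by (intro bexI[of _ "tail \<Omega> \<rho> ?G"]) auto
qed

lemma diagonal_tail_family_tails:
  assumes "weak_P_plus \<Omega> \<F> \<rho>" "has_small_accretions \<Lambda> \<Omega> \<F> \<rho>"
  shows "diagonal_tail_family \<Lambda> (tail \<Omega> \<rho> ` \<F>)"
proof -
  interpret tail_family \<Lambda> "tail \<Omega> \<rho> ` \<F>" by (rule tail_family_tails)
  show ?thesis
  proof
    fix t assume "t \<in> tail \<Omega> \<rho> ` \<F>"
    then obtain E where E: "E \<in> \<F>" "t = tail \<Omega> \<rho> E" by blast
    obtain F where F: "F \<in> \<F>" "\<rho> F \<subseteq> \<rho> E"
      and W: "\<forall>S. (\<forall>n. S n \<in> \<F> \<and> \<rho> (S n) \<subseteq> \<rho> F \<and> \<rho> (S (Suc n)) \<subseteq> \<rho> (S n)) \<longrightarrow>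
           (\<exists>G\<in>\<F>. \<forall>n. almost_subset \<Omega> \<rho> G (\<rho> (S n)))"
      using bspec[OF assms(1)[unfolded weak_P_plus_def] E(1)] by (elim bexE conjE)
    have "\<exists>u\<in>tail \<Omega> \<rho> ` \<F>. tail_refines u (\<lambda>n. S n 0)"
      if S: "\<forall>n. S n \<in> tail \<Omega> \<rho> ` \<F> \<and> S n 0 \<subseteq> tail \<Omega> \<rho> F 0 \<and> S (Suc n) 0 \<subseteq> S n 0" for S
    proof -
      from S have "\<forall>n. \<exists>G\<in>\<F>. S n = tail \<Omega> \<rho> G" by blast
      then obtain H where H: "\<And>n. H n \<in> \<F> \<and> S n = tail \<Omega> \<rho> (H n)" by metis
      have "\<exists>G\<in>\<F>. \<forall>n. almost_subset \<Omega> \<rho> G (\<rho> (H n))"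
        using S H by (intro W[rule_format]) (simp add: tail_0)
      then obtain G where "G \<in> \<F>" "\<And>n. almost_subset \<Omega> \<rho> G (\<rho> (H n))" by blast
      then have "tail_refines (tail \<Omega> \<rho> G) (\<lambda>n. S n 0)"
        unfolding almost_subset_def tail_refines_def
        using finite_diff_iff_tail H by (simp add: tail_0)
      with \<open>G \<in> \<F>\<close> show ?thesis by blast
    qed
    then show "\<exists>s\<in>tail \<Omega> \<rho> ` \<F>. s 0 \<subseteq> t 0 \<and>
      (\<forall>S. (\<forall>n. S n \<in> tail \<Omega> \<rho> ` \<F> \<and> S n 0 \<subseteq> s 0 \<and> S (Suc n) 0 \<subseteq> S n 0) \<longrightarrow>
        (\<exists>u\<in>tail \<Omega> \<rho> ` \<F>. tail_refines u (\<lambda>n. S n 0)))"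
      using E F by (intro bexI[of _ "tail \<Omega> \<rho> F"]) (auto simp: tail_0)
  next
    fix t assume "t \<in> tail \<Omega> \<rho> ` \<F>"
    then obtain E where E: "E \<in> \<F>" "t = tail \<Omega> \<rho> E" by blast
    from assms(2) E(1) obtain F where F: "F \<in> \<F>" "F \<subseteq> E" "set_has_small_accretions \<Lambda> \<Omega> \<F> \<rho> F"
      unfolding has_small_accretions_def by meson
    have "\<forall>u\<in>tail \<Omega> \<rho> ` \<F>. \<not> u 0 \<subseteq> tail \<Omega> \<rho> F 0 - tail \<Omega> \<rho> F n" for n
      using F(3) initial_segment_subset
      unfolding set_has_small_accretions_def ideal_of_def by (auto simp: tail_def)
    then show "\<exists>s\<in>tail \<Omega> \<rho> ` \<F>. (\<forall>n. s n \<subseteq> t n) \<and>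
        (\<forall>n. \<forall>u\<in>tail \<Omega> \<rho> ` \<F>. \<not> u 0 \<subseteq> s 0 - s n)"
      using E F tail_mono by (intro bexI[of _ "tail \<Omega> \<rho> F"]) blast+
  qed
qed

lemma rho_convergent_iff_tail:
  assumes "F \<in> \<F>"
  shows "rho_convergent \<Omega> \<rho> F X f x \<longleftrightarrow>
    x \<in> topspace X \<and> (\<forall>U. openin X U \<and> x \<in> U \<longrightarrow> (\<exists>n. f ` tail \<Omega> \<rho> F n \<subseteq> U))"
proof -
  have "(\<exists>K. K \<subseteq> \<Omega> \<and> finite K \<and> f ` \<rho> (F - K) \<subseteq> U) \<longleftrightarrow> (\<exists>n. f ` tail \<Omega> \<rho> F n \<subseteq> U)" for U
    using finite_diff_iff_tail[OF assms, of "f -` U"]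
    by (simp only: image_subset_iff_subset_vimage)
  then show ?thesis
    by (simp only: rho_convergent_def)
qed

lemma FinBW_iff_tail:
  "X \<in> FinBW \<Lambda> \<Omega> \<F> \<rho> \<longleftrightarrow> (\<forall>f \<in> \<Lambda> \<rightarrow> topspace X. \<exists>t\<in>tail \<Omega> \<rho> ` \<F>. \<exists>x\<in>topspace X.
     \<forall>U. openin X U \<and> x \<in> U \<longrightarrow> (\<exists>n. f ` t n \<subseteq> U))"
proof -
  have "(\<exists>x. rho_convergent \<Omega> \<rho> F X f x) \<longleftrightarrow> (\<exists>x\<in>topspace X.
      \<forall>U. openin X U \<and> x \<in> U \<longrightarrow> (\<exists>n. f ` tail \<Omega> \<rho> F n \<subseteq> U))" if "F \<in> \<F>" for F f
    by (simp only: rho_convergent_iff_tail[OF that] Bex_def)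
  then show ?thesis
    unfolding FinBW_def by (simp cong: ball_cong bex_cong)
qed

end

section \<open>The Katetov order and its effect on FinBW\<close>

lemma katetov_le_iff_tail:
  assumes "partition_regular \<Lambda>\<^sub>1 \<Omega>\<^sub>1 \<F>\<^sub>1 \<rho>\<^sub>1" "partition_regular \<Lambda>\<^sub>2 \<Omega>\<^sub>2 \<F>\<^sub>2 \<rho>\<^sub>2"
  shows "katetov_le \<Lambda>\<^sub>2 \<Omega>\<^sub>2 \<F>\<^sub>2 \<rho>\<^sub>2 \<Lambda>\<^sub>1 \<Omega>\<^sub>1 \<F>\<^sub>1 \<rho>\<^sub>1 \<longleftrightarrow>
    (\<exists>\<phi> \<in> \<Lambda>\<^sub>1 \<rightarrow> \<Lambda>\<^sub>2. \<forall>t\<in>tail \<Omega>\<^sub>1 \<rho>\<^sub>1 ` \<F>\<^sub>1. \<exists>s\<in>tail \<Omega>\<^sub>2 \<rho>\<^sub>2 ` \<F>\<^sub>2. tail_refines s (\<lambda>n. \<phi> ` t n))"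
proof -
  have "(\<forall>K. K \<subseteq> \<Omega>\<^sub>1 \<and> finite K \<longrightarrow> (\<exists>n. tail \<Omega>\<^sub>2 \<rho>\<^sub>2 F\<^sub>2 n \<subseteq> \<phi> ` \<rho>\<^sub>1 (F\<^sub>1 - K))) \<longleftrightarrow>
      tail_refines (tail \<Omega>\<^sub>2 \<rho>\<^sub>2 F\<^sub>2) (\<lambda>n. \<phi> ` tail \<Omega>\<^sub>1 \<rho>\<^sub>1 F\<^sub>1 n)" (is "?l \<longleftrightarrow> ?r")
    if F: "F\<^sub>1 \<in> \<F>\<^sub>1" for F\<^sub>1 F\<^sub>2 and \<phi> :: "'a \<Rightarrow> 'c"
  proof
    assume ?l
    then show ?r
      using initial_segment_subset[OF assms(1)] unfolding tail_refines_def
      by (auto simp: tail_def[of \<Omega>\<^sub>1])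
  next
    assume r: ?r
    show ?l
    proof (intro allI impI)
      fix K assume "K \<subseteq> \<Omega>\<^sub>1 \<and> finite K"
      then obtain n where "tail \<Omega>\<^sub>1 \<rho>\<^sub>1 F\<^sub>1 n \<subseteq> \<rho>\<^sub>1 (F\<^sub>1 - K)"
        using finite_diff_iff_tail[OF assms(1) F, of "\<rho>\<^sub>1 (F\<^sub>1 - K)"] by blast
      moreover obtain m where "tail \<Omega>\<^sub>2 \<rho>\<^sub>2 F\<^sub>2 m \<subseteq> \<phi> ` tail \<Omega>\<^sub>1 \<rho>\<^sub>1 F\<^sub>1 n"
        using r unfolding tail_refines_def by blast
      ultimately show "\<exists>n. tail \<Omega>\<^sub>2 \<rho>\<^sub>2 F\<^sub>2 n \<subseteq> \<phi> ` \<rho>\<^sub>1 (F\<^sub>1 - K)" by blast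
    qed
  qed
  then show ?thesis
    unfolding katetov_le_def using finite_diff_iff_tail[OF assms(2)]
    by (simp cong: ball_cong bex_cong)
qed

lemma katetov_le_FinBW_subset:
  assumes "partition_regular \<Lambda>\<^sub>1 \<Omega>\<^sub>1 \<F>\<^sub>1 \<rho>\<^sub>1" "partition_regular \<Lambda>\<^sub>2 \<Omega>\<^sub>2 \<F>\<^sub>2 \<rho>\<^sub>2"
    and "katetov_le \<Lambda>\<^sub>2 \<Omega>\<^sub>2 \<F>\<^sub>2 \<rho>\<^sub>2 \<Lambda>\<^sub>1 \<Omega>\<^sub>1 \<F>\<^sub>1 \<rho>\<^sub>1"
  shows "FinBW \<Lambda>\<^sub>1 \<Omega>\<^sub>1 \<F>\<^sub>1 \<rho>\<^sub>1 \<subseteq> FinBW \<Lambda>\<^sub>2 \<Omega>\<^sub>2 \<F>\<^sub>2 \<rho>\<^sub>2"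
proof
  fix X :: "'x topology" assume X: "X \<in> FinBW \<Lambda>\<^sub>1 \<Omega>\<^sub>1 \<F>\<^sub>1 \<rho>\<^sub>1"
  obtain \<phi> where \<phi>: "\<phi> \<in> \<Lambda>\<^sub>1 \<rightarrow> \<Lambda>\<^sub>2"
    "\<And>t. t \<in> tail \<Omega>\<^sub>1 \<rho>\<^sub>1 ` \<F>\<^sub>1 \<Longrightarrow> \<exists>s\<in>tail \<Omega>\<^sub>2 \<rho>\<^sub>2 ` \<F>\<^sub>2. tail_refines s (\<lambda>n. \<phi> ` t n)"
    using assms katetov_le_iff_tail by metis
  show "X \<in> FinBW \<Lambda>\<^sub>2 \<Omega>\<^sub>2 \<F>\<^sub>2 \<rho>\<^sub>2"
    unfolding FinBW_iff_tail[OF assms(2)]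
  proof
    fix f assume f: "f \<in> \<Lambda>\<^sub>2 \<rightarrow> topspace X"
    then have "f \<circ> \<phi> \<in> \<Lambda>\<^sub>1 \<rightarrow> topspace X" using \<phi>(1) by auto
    then obtain t x where t: "t \<in> tail \<Omega>\<^sub>1 \<rho>\<^sub>1 ` \<F>\<^sub>1" "x \<in> topspace X"
      "\<And>U. openin X U \<and> x \<in> U \<Longrightarrow> \<exists>n. (f \<circ> \<phi>) ` t n \<subseteq> U"
      using X unfolding FinBW_iff_tail[OF assms(1)] by meson
    obtain s where s: "s \<in> tail \<Omega>\<^sub>2 \<rho>\<^sub>2 ` \<F>\<^sub>2" "tail_refines s (\<lambda>n. \<phi> ` t n)"
      using \<phi>(2) t(1) by blast
    have "\<exists>m. f ` s m \<subseteq> U" if U: "openin X U \<and> x \<in> U" for U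
    proof -
      obtain n m where "(f \<circ> \<phi>) ` t n \<subseteq> U" "s m \<subseteq> \<phi> ` t n"
        using t(3)[OF U] s(2) unfolding tail_refines_def by meson
      then show ?thesis by (intro exI[of _ m]) fastforce
    qed
    with s(1) t(2) show "\<exists>s\<in>tail \<Omega>\<^sub>2 \<rho>\<^sub>2 ` \<F>\<^sub>2. \<exists>x\<in>topspace X.
        \<forall>U. openin X U \<and> x \<in> U \<longrightarrow> (\<exists>n. f ` s n \<subseteq> U)"
      by blast
  qed
qed

section \<open>Diagonalisation\<close>

text \<open>Split \<open>t 0\<close> by \<open>A\<close> and its complement: the hypothesis rules
  out the second piece. This serves to verify density: one can move into \<open>A\<close> as soon as
  nothing below \<open>t\<close> lies wholly outside \<open>A\<close>.\<close>

lemma (in tail_family) tail_subset_if_not_in_complement: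
  assumes "t \<in> T" and no: "\<And>s. s \<in> T \<Longrightarrow> s 0 \<subseteq> t 0 \<Longrightarrow> s 0 \<inter> A \<noteq> {}"
  shows "\<exists>s\<in>T. s 0 \<subseteq> t 0 \<inter> A"
proof -
  have "t 0 \<subseteq> A \<union> - A" by blast
  then obtain s where s: "s \<in> T" "s 0 \<subseteq> t 0 \<inter> A \<or> s 0 \<subseteq> t 0 \<inter> - A"
    using tail_split[OF assms(1)] by meson
  have "\<not> s 0 \<subseteq> t 0 \<inter> - A" using no[OF s(1)] by blast
  with s show ?thesis by blast
qed

context diagonal_tail_family
begin

text \<open>A fusion argument. Each \<open>\<D>\<close> in \<open>R\<close> is a demand, met by
  landing in one of its members, and the density hypothesis allows it to be met below any
  \<open>w\<close>. Meeting the demands one after another gives a decreasing sequence, and weak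
  \<open>P\<^sup>+\<close> gives a single set almost below all of it. The set \<open>s\<close> is
  fixed before \<open>R\<close> and \<open>u\<close>, so it serves several families of
  demands.\<close>

lemma diagonal_refinement:
  assumes "t \<in> T"
  obtains s where "s \<in> T" "s 0 \<subseteq> t 0"
    "\<And>R u. \<lbrakk>countable R; u \<in> T; u 0 \<subseteq> s 0;
        \<And>\<D> w. \<D> \<in> R \<Longrightarrow> w \<in> T \<Longrightarrow> w 0 \<subseteq> u 0 \<Longrightarrow> \<exists>A\<in>\<D>. \<exists>v\<in>T. v 0 \<subseteq> w 0 \<inter> A\<rbrakk> \<Longrightarrow>
      \<exists>v\<in>T. v 0 \<subseteq> u 0 \<and> (\<forall>\<D>\<in>R. \<exists>A\<in>\<D>. \<exists>m. v m \<subseteq> A)"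
proof -
  obtain s where s: "s \<in> T" "s 0 \<subseteq> t 0" and W: "\<And>S. (\<forall>n. S n \<in> T \<and> S n 0 \<subseteq> s 0 \<and>
      S (Suc n) 0 \<subseteq> S n 0) \<Longrightarrow> \<exists>u\<in>T. tail_refines u (\<lambda>n. S n 0)"
    using weak_P[OF assms] by blast
  have "\<exists>v\<in>T. v 0 \<subseteq> u 0 \<and> (\<forall>\<D>\<in>R. \<exists>A\<in>\<D>. \<exists>m. v m \<subseteq> A)"
    if R: "countable R" and u: "u \<in> T" "u 0 \<subseteq> s 0"
      and dense: "\<And>\<D> w. \<D> \<in> R \<Longrightarrow> w \<in> T \<Longrightarrow> w 0 \<subseteq> u 0 \<Longrightarrow> \<exists>A\<in>\<D>. \<exists>v\<in>T. v 0 \<subseteq> w 0 \<inter> A"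
    for R :: "'a set set set" and u
  proof -
    \<comment> \<open>The vacuous demand \<open>{UNIV}\<close> keeps the enumerated family nonempty
      even when \<open>R\<close> is empty.\<close>
    define R' where "R' = insert {UNIV} R"
    define e where "e = from_nat_into R'"
    have e: "range e = R'"
      unfolding e_def using R by (intro range_from_nat_into) (auto simp: R'_def)
    have dense': "\<exists>A\<in>\<D>. \<exists>v\<in>T. v 0 \<subseteq> w 0 \<inter> A" if "\<D> \<in> R'" "w \<in> T" "w 0 \<subseteq> u 0" for \<D> w
      using that dense by (auto simp: R'_def)
    have "\<exists>S. \<forall>n. (S n \<in> T \<and> S n 0 \<subseteq> u 0) \<and> (S (Suc n) 0 \<subseteq> S n 0 \<and> (\<exists>A\<in>e n. S (Suc n) 0 \<subseteq> A))"
    proof (rule dependent_nat_choice)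
      show "\<exists>w. w \<in> T \<and> w 0 \<subseteq> u 0" using u by blast
    next
      fix w n assume w: "w \<in> T \<and> w 0 \<subseteq> u 0"
      have "e n \<in> R'" using e by blast
      with w obtain A v where "A \<in> e n" "v \<in> T" "v 0 \<subseteq> w 0 \<inter> A"
        using dense' by meson
      with w show "\<exists>v. (v \<in> T \<and> v 0 \<subseteq> u 0) \<and> (v 0 \<subseteq> w 0 \<and> (\<exists>A\<in>e n. v 0 \<subseteq> A))"
        by blast
    qed
    then obtain S where S: "\<And>n. S n \<in> T" "\<And>n. S n 0 \<subseteq> u 0" "\<And>n. S (Suc n) 0 \<subseteq> S n 0"
        "\<And>n. \<exists>A\<in>e n. S (Suc n) 0 \<subseteq> A"
      by metis
    then obtain v' where v': "v' \<in> T" "tail_refines v' (\<lambda>n. S n 0)"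
      using W[of S] u(2) by (meson subset_trans)
    \<comment> \<open>\<open>v'\<close> is known to be inside \<open>u 0\<close> only from some tail
      on; shifting it brings the whole first term inside.\<close>
    obtain m where "v' m \<subseteq> u 0"
      using v'(2) S(2) unfolding tail_refines_def by (meson subset_trans)
    with tail_shift[OF v'(1), of m] obtain v where v: "v \<in> T" "v 0 \<subseteq> u 0" "tail_refines v v'"
      by blast
    have "\<exists>A\<in>\<D>. \<exists>m. v m \<subseteq> A" if "\<D> \<in> R" for \<D>
    proof -
      have "\<D> \<in> range e" using that e by (simp add: R'_def)
      then obtain n where n: "\<D> = e n" by blast
      with S(4) obtain A where A: "A \<in> \<D>" "S (Suc n) 0 \<subseteq> A" by blast
      obtain m where "v' m \<subseteq> S (Suc n) 0" using v'(2) unfolding tail_refines_def by blast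
      moreover obtain k where "v k \<subseteq> v' m" using v(3) unfolding tail_refines_def by blast
      ultimately show ?thesis using A by blast
    qed
    with v show ?thesis by blast
  qed
  with s show thesis by (rule that)
qed

text \<open>If \<open>f\<close> is constant on nothing below \<open>t\<close>, leaving a given fibre
  is a dense demand. There are only countably many fibres over \<open>L\<close>, so one
  \<open>v\<close> can leave all of them. Finite-to-one here means that every value is omitted on
  some tail of \<open>v\<close>.\<close>

lemma constant_or_finite_to_one:
  assumes "t \<in> T"
  shows "(\<exists>u\<in>T. \<exists>x. u 0 \<subseteq> t 0 \<and> f ` u 0 \<subseteq> {x}) \<or>
    (\<exists>v\<in>T. v 0 \<subseteq> t 0 \<and> (\<forall>x. \<exists>m. x \<notin> f ` v m))"
proof (rule disjCI)
  assume no: "\<not> (\<exists>v\<in>T. v 0 \<subseteq> t 0 \<and> (\<forall>x. \<exists>m. x \<notin> f ` v m))"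
  obtain s where s: "s \<in> T" "s 0 \<subseteq> t 0" and diag:
    "\<And>R u. \<lbrakk>countable R; u \<in> T; u 0 \<subseteq> s 0;
        \<And>\<D> w. \<D> \<in> R \<Longrightarrow> w \<in> T \<Longrightarrow> w 0 \<subseteq> u 0 \<Longrightarrow> \<exists>A\<in>\<D>. \<exists>v\<in>T. v 0 \<subseteq> w 0 \<inter> A\<rbrakk> \<Longrightarrow>
      \<exists>v\<in>T. v 0 \<subseteq> u 0 \<and> (\<forall>\<D>\<in>R. \<exists>A\<in>\<D>. \<exists>m. v m \<subseteq> A)"
    using diagonal_refinement[OF assms] by metis
  show "\<exists>u\<in>T. \<exists>x. u 0 \<subseteq> t 0 \<and> f ` u 0 \<subseteq> {x}"
  proof (rule ccontr)
    assume nc: "\<not> ?thesis"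
    let ?R = "(\<lambda>x. {{l. f l \<noteq> x}}) ` f ` L"
    have "\<exists>v\<in>T. v 0 \<subseteq> s 0 \<and> (\<forall>\<D>\<in>?R. \<exists>A\<in>\<D>. \<exists>m. v m \<subseteq> A)"
    proof (rule diag)
      show "countable ?R" using countable_base by blast
    next
      fix \<D> w assume "\<D> \<in> ?R" and w: "w \<in> T" "w 0 \<subseteq> s 0"
      then obtain x where x: "\<D> = {{l. f l \<noteq> x}}" by blast
      have "\<exists>v\<in>T. v 0 \<subseteq> w 0 \<inter> {l. f l \<noteq> x}"
      proof (rule tail_subset_if_not_in_complement[OF w(1)])
        fix v assume "v \<in> T" "v 0 \<subseteq> w 0"
        then have "\<not> f ` v 0 \<subseteq> {x}" using nc s(2) w(2) by (meson subset_trans)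
        then show "v 0 \<inter> {l. f l \<noteq> x} \<noteq> {}" by blast
      qed
      then show "\<exists>A\<in>\<D>. \<exists>v\<in>T. v 0 \<subseteq> w 0 \<inter> A" using x by simp
    qed (use s in auto)
    then obtain v where v: "v \<in> T" "v 0 \<subseteq> s 0" "\<forall>x\<in>f ` L. \<exists>m. v m \<subseteq> {l. f l \<noteq> x}" by auto
    have "\<exists>m. x \<notin> f ` v m" for x
    proof (cases "x \<in> f ` L")
      case True
      then obtain m where "v m \<subseteq> {l. f l \<noteq> x}" using v(3) by meson
      then show ?thesis by blast
    next
      case False
      then show ?thesis using tail_subset[OF v(1)] by blast
    qed
    with no v s(2) show False by blast
  qed
qed

text \<open>
  Here \<open>z\<close> is a dummy value marking the arguments at which a map into the space misses the dense
  set \<open>N\<close>, and \<open>Q\<close> collects the neighbourhood bases of the points added so far.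
\<close>

lemma new_neighbourhood_base:
  fixes N :: "'x set"
  assumes h: "h \<in> L \<rightarrow> insert z N" and z: "z \<notin> N" and N: "countable N" "N \<noteq> {}"
    and Q: "countable Q" "\<And>d. d \<in> Q \<Longrightarrow> antimono d"
    and T': "\<And>\<phi>. \<phi> \<in> L \<rightarrow> N \<Longrightarrow> \<exists>t\<in>T. \<forall>s\<in>T'. \<not> tail_refines s (\<lambda>n. \<phi> ` t n)"
    and no_z: "\<And>t. t \<in> T \<Longrightarrow> \<not> h ` t 0 \<subseteq> {z}"
    and no_const: "\<And>t x. t \<in> T \<Longrightarrow> x \<in> N \<Longrightarrow> \<not> h ` t 0 \<subseteq> {x}"
    and no_old: "\<And>t d. t \<in> T \<Longrightarrow> d \<in> Q \<Longrightarrow> \<not> tail_refines (\<lambda>n. h ` t n) d"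
  shows "\<exists>t\<in>T. h ` t 0 \<subseteq> N \<and> (\<forall>x. \<exists>n. x \<notin> h ` t n) \<and> (\<forall>s\<in>T'. \<not> tail_refines s (\<lambda>n. h ` t n)) \<and>
     (\<forall>d\<in>Q. \<exists>n. h ` t n \<inter> d n = {})"
proof -
  obtain y where y: "y \<in> N" using N by blast
  \<comment> \<open>Failure of Katetov reducibility concerns maps into \<open>N\<close>, so the
    dummy \<open>z\<close> is replaced by an arbitrary \<open>y\<close>; the change is invisible
    where \<open>h\<close> differs from \<open>z\<close>.\<close>
  define \<phi> where "\<phi> l = (if h l = z then y else h l)" for l
  have "\<phi> \<in> L \<rightarrow> N" using h y by (auto simp: \<phi>_def)
  then obtain t where t: "t \<in> T" "\<And>s. s \<in> T' \<Longrightarrow> \<not> tail_refines s (\<lambda>n. \<phi> ` t n)"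
    using T' by meson
  \<comment> \<open>Small accretions: no \<open>u 0\<close> fits into \<open>t' 0 - t' n\<close>, so
    below \<open>t'\<close> one can always thin out into \<open>t' n\<close>.\<close>
  obtain t' where t': "t' \<in> T" "\<And>n. t' n \<subseteq> t n" "\<And>n u. u \<in> T \<Longrightarrow> \<not> u 0 \<subseteq> t' 0 - t' n"
    using small_accretions[OF t(1)] by meson
  obtain s where s: "s \<in> T" "s 0 \<subseteq> t' 0" and diag:
    "\<And>R u. \<lbrakk>countable R; u \<in> T; u 0 \<subseteq> s 0;
        \<And>\<D> w. \<D> \<in> R \<Longrightarrow> w \<in> T \<Longrightarrow> w 0 \<subseteq> u 0 \<Longrightarrow> \<exists>A\<in>\<D>. \<exists>v\<in>T. v 0 \<subseteq> w 0 \<inter> A\<rbrakk> \<Longrightarrow>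
      \<exists>v\<in>T. v 0 \<subseteq> u 0 \<and> (\<forall>\<D>\<in>R. \<exists>A\<in>\<D>. \<exists>m. v m \<subseteq> A)"
    using diagonal_refinement[OF t'(1)] by metis
  \<comment> \<open>Since \<open>h\<close> is constantly \<open>z\<close> on no \<open>t 0\<close>,
    the construction can move to where \<open>h\<close> takes values in \<open>N\<close>, and there
    \<open>h\<close> agrees with \<open>\<phi>\<close>.\<close>
  have "\<exists>u\<in>T. u 0 \<subseteq> s 0 \<inter> {l. h l \<noteq> z}"
    using s(1)
  proof (rule tail_subset_if_not_in_complement)
    fix v assume "v \<in> T"
    then show "v 0 \<inter> {l. h l \<noteq> z} \<noteq> {}" using no_z[of v] by blast
  qed
  then obtain u where u: "u \<in> T" and u0: "u 0 \<subseteq> s 0" "u 0 \<subseteq> {l. h l \<noteq> z}" by blast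
  have in_t': "\<exists>v\<in>T. v 0 \<subseteq> w 0 \<inter> t' n" if "w \<in> T" "w 0 \<subseteq> u 0" for w n
    using that(1)
  proof (rule tail_subset_if_not_in_complement)
    fix v assume "v \<in> T" "v 0 \<subseteq> w 0"
    then show "v 0 \<inter> t' n \<noteq> {}" using t'(3)[of v n] that(2) u0(1) s(2) by blast
  qed
  have off_point: "\<exists>v\<in>T. v 0 \<subseteq> w 0 \<inter> {l. h l \<noteq> x}" if "w \<in> T" "x \<in> N" for w x
    using that(1)
  proof (rule tail_subset_if_not_in_complement)
    fix v assume "v \<in> T"
    then show "v 0 \<inter> {l. h l \<noteq> x} \<noteq> {}" using no_const[of v x] that(2) by blast
  qed
  \<comment> \<open>Otherwise, for every \<open>n\<close>, entering \<open>d n\<close> would be a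
    dense demand below \<open>w\<close>, and the fusion would produce a \<open>v\<close> along which
    \<open>h\<close> converges to the old base \<open>d\<close>.\<close>
  have off_base: "\<exists>n. \<exists>v\<in>T. v 0 \<subseteq> w 0 \<inter> {l. h l \<notin> d n}" if "w \<in> T" "w 0 \<subseteq> u 0" "d \<in> Q" for w d
  proof (rule ccontr)
    assume no: "\<not> ?thesis"
    let ?R = "range (\<lambda>n. {{l. h l \<in> d n}})"
    have "\<exists>v\<in>T. v 0 \<subseteq> w 0 \<and> (\<forall>\<D>\<in>?R. \<exists>A\<in>\<D>. \<exists>m. v m \<subseteq> A)"
    proof (rule diag)
      fix \<D> w' assume "\<D> \<in> ?R" and w': "w' \<in> T" "w' 0 \<subseteq> w 0"
      then obtain n where n: "\<D> = {{l. h l \<in> d n}}" by blast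
      have "\<exists>v\<in>T. v 0 \<subseteq> w' 0 \<inter> {l. h l \<in> d n}"
        using w'(1)
      proof (rule tail_subset_if_not_in_complement)
        fix v assume "v \<in> T" "v 0 \<subseteq> w' 0"
        moreover from this no have "\<not> v 0 \<subseteq> w 0 \<inter> {l. h l \<notin> d n}" by meson
        ultimately show "v 0 \<inter> {l. h l \<in> d n} \<noteq> {}" using w'(2) by blast
      qed
      then show "\<exists>A\<in>\<D>. \<exists>v\<in>T. v 0 \<subseteq> w' 0 \<inter> A" using n by simp
    qed (use that u0 in auto)
    then obtain v where "v \<in> T" "\<And>n. \<exists>m. v m \<subseteq> {l. h l \<in> d n}" by auto
    then have "tail_refines (\<lambda>m. h ` v m) d" unfolding tail_refines_def by blast
    with no_old \<open>v \<in> T\<close> that(3) show False by blast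
  qed
  \<comment> \<open>Three kinds of demands: enter every \<open>t' n\<close>, which keeps members of
    \<open>T'\<close> from refining the images; leave every point of \<open>N\<close>; avoid some
    term of every old base. In the last kind the index is free, hence a demand with many
    alternatives.\<close>
  let ?R = "range (\<lambda>n. {t' n}) \<union> (\<lambda>x. {{l. h l \<noteq> x}}) ` N \<union> (\<lambda>d. range (\<lambda>n. {l. h l \<notin> d n})) ` Q"
  have "\<exists>v\<in>T. v 0 \<subseteq> u 0 \<and> (\<forall>\<D>\<in>?R. \<exists>A\<in>\<D>. \<exists>m. v m \<subseteq> A)"
  proof (rule diag)
    show "countable ?R" using N(1) Q(1) by (intro countable_Un countable_image) auto
  next
    fix \<D> w assume \<D>: "\<D> \<in> ?R" and w: "w \<in> T" "w 0 \<subseteq> u 0"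
    from \<D> consider n where "\<D> = {t' n}" | x where "x \<in> N" "\<D> = {{l. h l \<noteq> x}}"
      | d where "d \<in> Q" "\<D> = range (\<lambda>n. {l. h l \<notin> d n})"
      by blast
    then show "\<exists>A\<in>\<D>. \<exists>v\<in>T. v 0 \<subseteq> w 0 \<inter> A"
    proof cases
      case 1
      then show ?thesis using in_t'[OF w] by simp
    next
      case 2
      then show ?thesis using off_point[OF w(1)] by simp
    next
      case 3
      then show ?thesis using off_base[OF w] by simp
    qed
  qed (use u u0 in auto)
  then obtain v where v: "v \<in> T" "v 0 \<subseteq> u 0" and vR: "\<And>\<D>. \<D> \<in> ?R \<Longrightarrow> \<exists>A\<in>\<D>. \<exists>m. v m \<subseteq> A"
    by meson
  have v_t': "\<exists>m. v m \<subseteq> t' n" for n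
    using vR[of "{t' n}"] by auto
  have v_point: "\<exists>m. v m \<subseteq> {l. h l \<noteq> x}" if "x \<in> N" for x
    using vR[of "{{l. h l \<noteq> x}}"] that by auto
  have v_base: "\<exists>n m. v m \<subseteq> {l. h l \<notin> d n}" if "d \<in> Q" for d
    using vR[of "range (\<lambda>n. {l. h l \<notin> d n})"] that by auto
  have v_sub: "v n \<subseteq> u 0" for n
    using tail_antimono[OF v(1), of 0 n] v(2) by auto
  have hN: "h ` v n \<subseteq> N" for n
    using v_sub[of n] u0(2) h tail_subset[OF v(1), of n] by fastforce
  have "\<exists>n. x \<notin> h ` v n" for x
    using v_point[of x] hN by (cases "x \<in> N") blast+
  moreover have "\<not> tail_refines s' (\<lambda>n. h ` v n)" if "s' \<in> T'" for s'
  proof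
    assume "tail_refines s' (\<lambda>n. h ` v n)"
    \<comment> \<open>Any \<open>s'\<close> refining the images of \<open>v\<close> would also
      refine the images of \<open>t\<close> under \<open>\<phi>\<close>, against the choice of
      \<open>t\<close>.\<close>
    moreover have "tail_refines (\<lambda>n. h ` v n) (\<lambda>n. \<phi> ` t n)"
      unfolding tail_refines_def
    proof
      fix n
      obtain m where "v m \<subseteq> t n" using v_t'[of n] t'(2) by blast
      moreover have "h ` v m = \<phi> ` v m"
        using v_sub[of m] u0(2) by (intro image_cong) (auto simp: \<phi>_def)
      ultimately show "\<exists>m. h ` v m \<subseteq> \<phi> ` t n" by blast
    qed
    ultimately have "tail_refines s' (\<lambda>n. \<phi> ` t n)"
      unfolding tail_refines_def by (meson subset_trans)
    with t(2) that show False by blast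
  qed
  moreover have "\<exists>n. h ` v n \<inter> d n = {}" if d: "d \<in> Q" for d
  proof -
    obtain n m where nm: "v m \<subseteq> {l. h l \<notin> d n}" using v_base[OF d] by blast
    have "v (max m n) \<subseteq> v m" "d (max m n) \<subseteq> d n"
      using tail_antimono[OF v(1)] Q(2)[OF d] by (auto simp: antimono_def)
    with nm show ?thesis by (intro exI[of _ "max m n"]) blast
  qed
  ultimately show ?thesis using v(1) hN by (intro bexI[of _ v] conjI) simp_all
qed

end

section \<open>The space\<close>

text \<open>
  A variant of the Mrowka space: points of \<open>N\<close> are isolated, \<open>D i\<close> is a neighbourhood base (on \<open>N\<close>)
  at \<open>i \<in> I\<close>, and a neighbourhood of the extra point \<open>z\<close> contains all but finitely many points
  of \<open>I\<close>, with no further restriction on its trace on \<open>N\<close>.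
\<close>

definition limit_points_topology ::
  "'x set \<Rightarrow> 'x set \<Rightarrow> 'x \<Rightarrow> ('x \<Rightarrow> nat \<Rightarrow> 'x set) \<Rightarrow> 'x topology" where
  "limit_points_topology N I z D = topology (\<lambda>U. U \<subseteq> insert z (N \<union> I) \<and>
     (\<forall>i\<in>U \<inter> I. \<exists>n. D i n \<subseteq> U) \<and> (z \<in> U \<longrightarrow> finite (I - U)))"

text \<open>\<open>D_avoid\<close> makes points closed and \<open>D_disjoint\<close> gives disjoint
  neighbourhoods of distinct points of \<open>I\<close>; no assumption provides disjoint
  neighbourhoods of \<open>z\<close> and a point of \<open>I\<close>.\<close>

locale limit_points_space =
  fixes N I :: "'x set" and z :: 'x and D :: "'x \<Rightarrow> nat \<Rightarrow> 'x set" and X :: "'x topology"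
  assumes X_def: "X = limit_points_topology N I z D"
    and disjoint: "N \<inter> I = {}" "z \<notin> N" "z \<notin> I"
    and countable_N: "countable N"
    and D_antimono: "i \<in> I \<Longrightarrow> antimono (D i)"
    and D_subset: "i \<in> I \<Longrightarrow> D i n \<subseteq> N"
    and D_nonempty: "i \<in> I \<Longrightarrow> D i n \<noteq> {}"
    and D_avoid: "i \<in> I \<Longrightarrow> \<exists>n. x \<notin> D i n"
    and D_disjoint: "i \<in> I \<Longrightarrow> j \<in> I \<Longrightarrow> i \<noteq> j \<Longrightarrow> \<exists>n. D i n \<inter> D j n = {}"
begin

lemma D_mono: "i \<in> I \<Longrightarrow> m \<le> n \<Longrightarrow> D i n \<subseteq> D i m"
  using D_antimono by (auto dest: antimonoD)

lemma openin_iff: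
  "openin X U \<longleftrightarrow> U \<subseteq> insert z (N \<union> I) \<and>
     (\<forall>i\<in>U \<inter> I. \<exists>n. D i n \<subseteq> U) \<and> (z \<in> U \<longrightarrow> finite (I - U))"
proof -
  have "istopology (\<lambda>U. U \<subseteq> insert z (N \<union> I) \<and>
     (\<forall>i\<in>U \<inter> I. \<exists>n. D i n \<subseteq> U) \<and> (z \<in> U \<longrightarrow> finite (I - U)))" (is "istopology ?P")
    unfolding istopology_def
  proof (rule conjI; intro allI impI)
    fix S U assume S: "?P S" and U: "?P U"
    have "\<exists>n. D i n \<subseteq> S \<inter> U" if "i \<in> S \<inter> U \<inter> I" for i
    proof -
      obtain m n where "D i m \<subseteq> S" "D i n \<subseteq> U" using S U \<open>i \<in> S \<inter> U \<inter> I\<close> by blast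
      then show ?thesis
        using D_mono[of i m "max m n"] D_mono[of i n "max m n"] that
        by (intro exI[of _ "max m n"]) auto
    qed
    moreover have "I - S \<inter> U = (I - S) \<union> (I - U)" by blast
    ultimately show "?P (S \<inter> U)" using S U by auto
  next
    fix \<K> assume \<K>: "\<forall>K\<in>\<K>. ?P K"
    have "\<exists>n. D i n \<subseteq> \<Union>\<K>" if "i \<in> \<Union>\<K> \<inter> I" for i
    proof -
      from that obtain K where "K \<in> \<K>" "i \<in> K \<inter> I" by blast
      with \<K> obtain n where "D i n \<subseteq> K" by meson
      with \<open>K \<in> \<K>\<close> show ?thesis by blast
    qed
    moreover have "finite (I - \<Union>\<K>)" if "z \<in> \<Union>\<K>"
    proof -
      from that obtain K where "K \<in> \<K>" "z \<in> K" by blast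
      with \<K> have "finite (I - K)" by blast
      then show ?thesis by (rule rev_finite_subset) (use \<open>K \<in> \<K>\<close> in blast)
    qed
    moreover have "\<Union>\<K> \<subseteq> insert z (N \<union> I)" using \<K> by blast
    ultimately show "?P (\<Union>\<K>)" by blast
  qed
  then show ?thesis
    unfolding X_def limit_points_topology_def by (simp add: topology_inverse')
qed

lemma topspace_eq: "topspace X = insert z (N \<union> I)"
proof
  show "topspace X \<subseteq> insert z (N \<union> I)"
    using openin_topspace[of X] unfolding openin_iff by blast
  have "finite (I - insert z (N \<union> I))" by (rule finite_subset[of _ "{}"]) auto
  moreover have "D i n \<subseteq> insert z (N \<union> I)" if "i \<in> I" for i n
    using D_subset[OF that] by blast
  ultimately have "openin X (insert z (N \<union> I))"
    unfolding openin_iff by blast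
  then show "insert z (N \<union> I) \<subseteq> topspace X" by (rule openin_subset)
qed

lemma openin_isolated: "x \<in> N \<Longrightarrow> openin X {x}"
  unfolding openin_iff using disjoint by blast

lemma openin_basic: "i \<in> I \<Longrightarrow> openin X (insert i (D i n))"
  unfolding openin_iff using disjoint D_subset[of i n] by auto

lemma D_avoid_finite:
  assumes "i \<in> I" "finite C"
  shows "\<exists>n. D i n \<inter> C = {}"
  using assms(2)
proof induction
  case (insert x C)
  then obtain m n where mn: "D i m \<inter> C = {}" "x \<notin> D i n"
    using D_avoid[OF assms(1)] by blast
  have "D i (max m n) \<subseteq> D i m" "D i (max m n) \<subseteq> D i n"
    using D_mono[OF assms(1)] by simp_all
  then have "D i (max m n) \<inter> insert x C = {}" using mn by blast
  then show ?case ..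
qed simp

lemma openin_diff_singleton: "openin X (topspace X - {x})"
proof -
  have "\<exists>n. D i n \<subseteq> topspace X - {x}" if "i \<in> I" for i
    using D_avoid[OF that, of x] D_subset[OF that] unfolding topspace_eq by blast
  moreover have "finite (I - (topspace X - {x}))"
    by (rule finite_subset[of _ "{x}"]) (auto simp: topspace_eq)
  ultimately show ?thesis
    unfolding openin_iff by (auto simp: topspace_eq)
qed

text \<open>\<open>B\<close> is a set converging to \<open>a\<close>. Another point \<open>i\<close>
  of \<open>I\<close> has a basic set disjoint from some \<open>D a m\<close>, and the finitely many
  points of \<open>B\<close> outside \<open>D a m\<close> are avoided by going further down. At
  \<open>z\<close> only the single point \<open>a\<close> of \<open>I\<close> is lost.\<close>

lemma openin_diff_convergent:
  assumes a: "a \<in> I" and B: "B \<subseteq> N" "\<And>n. finite (B - D a n)"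
  shows "openin X (topspace X - insert a B)"
proof -
  have "\<exists>n. D i n \<subseteq> topspace X - insert a B" if i: "i \<in> I" "i \<noteq> a" for i
  proof -
    obtain m where m: "D i m \<inter> D a m = {}" using D_disjoint[OF i(1) a i(2)] by blast
    obtain n where n: "D i n \<inter> (B - D a m) = {}" using D_avoid_finite[OF i(1) B(2)] by blast
    have "D i (max m n) \<subseteq> D i m" "D i (max m n) \<subseteq> D i n"
      using D_mono[OF i(1)] by simp_all
    then have "D i (max m n) \<inter> B = {}" using m n by blast
    moreover have "D i (max m n) \<subseteq> N" using D_subset i by blast
    moreover have "a \<notin> N" using a disjoint by blast
    ultimately show ?thesis unfolding topspace_eq by blast
  qed
  moreover have "I - (topspace X - insert a B) = {a}"
    using a B(1) disjoint unfolding topspace_eq by blast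
  ultimately show ?thesis
    unfolding openin_iff by (auto simp: topspace_eq)
qed

lemma separable: "separable_space X"
  unfolding separable_space_def
proof (intro exI conjI)
  \<comment> \<open>Including \<open>z\<close> in the dense set leaves only the points of
    \<open>I\<close> to be approximated.\<close>
  show "countable (insert z N)" using countable_N by simp
  show "insert z N \<subseteq> topspace X" by (auto simp: topspace_eq)
  show "X closure_of insert z N = topspace X"
  proof
    show "topspace X \<subseteq> X closure_of insert z N"
    proof
      fix x assume x: "x \<in> topspace X"
      have "\<exists>y\<in>insert z N. y \<in> U" if U: "x \<in> U" "openin X U" for U
      proof (cases "x \<in> I")
        case True
        then obtain n where "D x n \<subseteq> U" using U unfolding openin_iff by blast
        moreover have "D x n \<noteq> {}" "D x n \<subseteq> N" using True D_nonempty D_subset by auto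
        ultimately show ?thesis by blast
      next
        case False
        then show ?thesis using x U unfolding topspace_eq by blast
      qed
      with x show "x \<in> X closure_of insert z N" unfolding in_closure_of by blast
    qed
  qed (rule closure_of_subset_topspace)
qed

text \<open>Points are closed, so a sequence with two distinct limits eventually avoids both. Hence
  neither limit is isolated, and a limit \<open>a\<close> in \<open>I\<close> forces the sequence
  eventually into every \<open>D a k\<close>. Two limits in \<open>I\<close> contradict
  \<open>D_disjoint\<close>; if the other limit is \<open>z\<close>, deleting \<open>a\<close> and a
  tail of the sequence leaves a neighbourhood of \<open>z\<close>.\<close>

lemma unique_limits: "unique_sequential_limits X"
proof -
  have avoid: "\<forall>\<^sub>F n in sequentially. s n \<noteq> x" if "limitin X s b sequentially" "x \<noteq> b" for s b x
  proof -
    have "b \<in> topspace X - {x}" using that by (auto simp: limitin_def)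
    then have "\<forall>\<^sub>F n in sequentially. s n \<in> topspace X - {x}"
      using that(1) openin_diff_singleton unfolding limitin_def by blast
    then show ?thesis by (rule eventually_mono) blast
  qed
  have isolated: "a \<notin> N"
    if lim: "limitin X s a sequentially" "limitin X s b sequentially" "a \<noteq> b" for s a b
  proof
    assume "a \<in> N"
    then have "\<forall>\<^sub>F n in sequentially. s n \<in> {a}"
      using lim(1) openin_isolated unfolding limitin_def by blast
    with avoid[OF lim(2,3)] have "\<forall>\<^sub>F n in sequentially. False"
      by eventually_elim simp
    then show False by simp
  qed
  have basic: "\<forall>\<^sub>F n in sequentially. s n \<in> D a k"
    if lim: "limitin X s a sequentially" "limitin X s b sequentially" "a \<noteq> b" and a: "a \<in> I" for s a b k
  proof -
    have "\<forall>\<^sub>F n in sequentially. s n \<in> insert a (D a k)"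
      using lim(1) openin_basic[OF a] unfolding limitin_def by blast
    with avoid[OF lim(2,3)] show ?thesis by eventually_elim simp
  qed
  have not_z: "b \<noteq> z"
    if lim: "limitin X s a sequentially" "limitin X s b sequentially" "a \<noteq> b" and a: "a \<in> I" for s a b
  proof
    assume "b = z"
    obtain n0 where n0: "\<And>n. n \<ge> n0 \<Longrightarrow> s n \<in> D a 0"
      using basic[OF lim a] unfolding eventually_sequentially by blast
    let ?B = "s ` {n0..}"
    have "finite (?B - D a k)" for k
    proof -
      obtain n1 where "\<And>n. n \<ge> n1 \<Longrightarrow> s n \<in> D a k"
        using basic[OF lim a] unfolding eventually_sequentially by blast
      then have "?B - D a k \<subseteq> s ` {..<n1}" by (force simp: not_le)
      then show ?thesis by (rule finite_subset) simp
    qed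
    moreover have BN: "?B \<subseteq> N" using n0 D_subset[OF a] by blast
    ultimately have "openin X (topspace X - insert a ?B)"
      using openin_diff_convergent[OF a] by blast
    moreover have "z \<in> topspace X - insert a ?B"
      using BN a disjoint by (auto simp: topspace_eq)
    ultimately have "\<forall>\<^sub>F n in sequentially. s n \<in> topspace X - insert a ?B"
      using lim(2) \<open>b = z\<close> unfolding limitin_def by blast
    moreover have "\<forall>\<^sub>F n in sequentially. n \<ge> n0" by (rule eventually_ge_at_top)
    ultimately have "\<forall>\<^sub>F n in sequentially. False" by eventually_elim simp
    then show False by simp
  qed
  have "a = b" if lim: "limitin X s a sequentially" "limitin X s b sequentially" for s a b
  proof (rule ccontr)
    assume ab: "a \<noteq> b"
    then have ba: "b \<noteq> a" by simp
    have "a \<in> I \<or> a = z" "b \<in> I \<or> b = z"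
      using isolated[OF lim ab] isolated[OF lim(2,1) ba] lim
      unfolding limitin_def topspace_eq by blast+
    then have I: "a \<in> I" "b \<in> I"
      using not_z[OF lim ab] not_z[OF lim(2,1) ba] ab by blast+
    then obtain k where "D a k \<inter> D b k = {}" using D_disjoint ab by blast
    moreover have "\<forall>\<^sub>F n in sequentially. s n \<in> D a k \<inter> D b k"
      using basic[OF lim ab I(1), of k] basic[OF lim(2,1) ba I(2), of k]
      by eventually_elim simp
    ultimately have "\<forall>\<^sub>F n in sequentially. False" by simp
    then show False by simp
  qed
  then show ?thesis unfolding unique_sequential_limits_def by blast
qed

end

section \<open>The construction under the Continuum Hypothesis\<close>

text \<open>A cardinal well-order of the reals has proper initial segments of cardinality below the
  continuum, and CH makes these countable. The order is taken strict so that recursion along it is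
  well-founded.\<close>

lemma continuum_hypothesis_countable_initial_segments:
  assumes continuum_hypothesis
  obtains R :: "(real \<times> real) set"
  where "wf R" "\<And>i. countable {j. (j, i) \<in> R}" "\<And>i j. i \<noteq> j \<Longrightarrow> (i, j) \<in> R \<or> (j, i) \<in> R"
proof -
  define r where "r = card_of (UNIV :: real set)"
  have wo: "well_order_on UNIV r"
    unfolding r_def by (rule card_of_well_order_on)
  have "wf (r - Id)" using wo by (simp add: well_order_on_def)
  moreover have "countable {j. (j, i) \<in> r - Id}" for i
  proof -
    have "{j. (j, i) \<in> r - Id} = underS r i" by (auto simp: underS_def)
    moreover have "(card_of (underS r i), r) \<in> ordLess"
      unfolding r_def by (rule card_of_underS[OF card_of_Card_order]) (simp add: Field_card_of)
    then have "\<not> underS r i \<approx> (UNIV :: real set)"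
      unfolding r_def eqpoll_iff_card_of_ordIso by (simp add: not_ordLess_ordIso)
    ultimately show ?thesis
      using assms unfolding continuum_hypothesis_def by metis
  qed
  moreover have "(i, j) \<in> r - Id \<or> (j, i) \<in> r - Id" if "i \<noteq> j" for i j
    using wo that by (auto simp: well_order_on_def linear_order_on_def total_on_def)
  ultimately show thesis by (rule that)
qed

text \<open>Coding graphs as sets of naturals bounds the number of maps by the continuum. The
  indices are positive because an index will double as an added point; the negative reals and 0 are
  reserved for the isolated points and infinity.\<close>

lemma enumerate_functions_by_positive_reals:
  assumes "countable A" "countable B" "B \<noteq> {}"
  obtains h :: "real \<Rightarrow> 'a \<Rightarrow> 'b"
  where "\<And>i. h i \<in> A \<rightarrow> B" "\<And>f. f \<in> A \<rightarrow> B \<Longrightarrow> \<exists>i>0. \<forall>a\<in>A. h i a = f a"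
proof -
  define c where "c f = (\<lambda>a. prod_encode (to_nat_on A a, to_nat_on B (f a))) ` A" for f :: "'a \<Rightarrow> 'b"
  have "inj_on c (A \<rightarrow>\<^sub>E B)"
  proof (rule inj_onI)
    fix f g assume fg: "f \<in> A \<rightarrow>\<^sub>E B" "g \<in> A \<rightarrow>\<^sub>E B" "c f = c g"
    show "f = g"
    proof (rule PiE_ext[OF fg(1,2)])
      fix a assume a: "a \<in> A"
      then have "prod_encode (to_nat_on A a, to_nat_on B (f a)) \<in> c f"
        unfolding c_def by blast
      then have "prod_encode (to_nat_on A a, to_nat_on B (f a)) \<in> c g"
        using fg(3) by simp
      then obtain b where b: "b \<in> A" "to_nat_on A a = to_nat_on A b" "to_nat_on B (f a) = to_nat_on B (g b)"
        unfolding c_def by (auto simp: prod_encode_eq)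
      then have "a = b" using a assms(1) by (metis to_nat_on_inj)
      with b fg a show "f a = g a" by (metis PiE_mem assms(2) to_nat_on_inj)
    qed
  qed
  then have "(A \<rightarrow>\<^sub>E B) \<lesssim> (UNIV :: nat set set)"
    unfolding lepoll_def by blast
  also have "(UNIV :: nat set set) \<lesssim> {0..<1::real}" by (rule nat_sets_lepoll_reals01)
  also have "{0..<1::real} \<lesssim> {0::real<..}"
    unfolding lepoll_def by (intro exI[of _ "\<lambda>x. x + 1"]) (auto simp: inj_on_def)
  finally obtain g where g: "(A \<rightarrow>\<^sub>E B) \<subseteq> g ` {0::real<..}"
    unfolding lepoll_iff by blast
  obtain y where y: "y \<in> B" using assms(3) by blast
  define h where "h i = (if g i \<in> A \<rightarrow>\<^sub>E B then g i else (\<lambda>_. y))" for i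
  show thesis
  proof (rule that)
    show "h i \<in> A \<rightarrow> B" for i
      using y by (auto simp: h_def)
  next
    fix f assume "f \<in> A \<rightarrow> B"
    then have "restrict f A \<in> A \<rightarrow>\<^sub>E B" by (simp add: restrict_PiE_iff Pi_iff)
    with g have "restrict f A \<in> g ` {0<..}" by (rule subsetD)
    then obtain i where "i > 0" "g i = restrict f A" by auto
    with \<open>restrict f A \<in> A \<rightarrow>\<^sub>E B\<close> show "\<exists>i>0. \<forall>a\<in>A. h i a = f a"
      by (intro exI[of _ i]) (simp add: h_def)
  qed
qed

lemma injective_choice:
  fixes A :: "nat \<Rightarrow> 'a set"
  assumes "\<And>n. infinite (A n)"
  obtains c where "inj c" "\<And>n. c n \<in> A n"
proof -
  have "\<exists>c. \<forall>n. c n \<in> A n \<and> c n \<notin> c ` {..<n}"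
  proof (rule dependent_wf_choice[OF wf_less_than])
    fix c c' :: "nat \<Rightarrow> 'a" and n r assume "\<And>m. (m, n) \<in> less_than \<Longrightarrow> c m = c' m"
    then have "c ` {..<n} = c' ` {..<n}" by (intro image_cong) auto
    then show "(r \<in> A n \<and> r \<notin> c ` {..<n}) = (r \<in> A n \<and> r \<notin> c' ` {..<n})" by simp
  next
    fix n and c :: "nat \<Rightarrow> 'a"
    have "infinite (A n - c ` {..<n})" using assms by (simp add: Diff_infinite_finite)
    then have "A n - c ` {..<n} \<noteq> {}" by (metis finite.emptyI)
    then show "\<exists>r. r \<in> A n \<and> r \<notin> c ` {..<n}" by blast
  qed
  then obtain c where c: "\<And>n. c n \<in> A n" "\<And>n. c n \<notin> c ` {..<n}" by blast
  have "c m \<noteq> c n" if "m < n" for m n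
    using c(2)[of n] that by (metis image_eqI lessThan_iff)
  then have "inj c" by (rule linorder_injI)
  with c(1) show thesis by (rule that[rotated])
qed

section \<open>Transfinite recursion over the maps, and the resulting space\<close>

context diagonal_tail_family
begin

text \<open>The cases in which \<open>h\<close> needs no new point. Constancy at the dummy
  \<open>z\<close> is listed apart because \<open>z\<close> conceals the original values of a map
  into the space, which then have to be examined separately.\<close>

definition converges_to_base ::
  "'x set \<Rightarrow> 'x \<Rightarrow> (nat \<Rightarrow> 'x set) set \<Rightarrow> ('a \<Rightarrow> 'x) \<Rightarrow> bool" where
  "converges_to_base N z Q h \<longleftrightarrow> (\<exists>t\<in>T. h ` t 0 \<subseteq> {z}) \<or> (\<exists>t\<in>T. \<exists>x\<in>N. h ` t 0 \<subseteq> {x}) \<or>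
     (\<exists>t\<in>T. \<exists>d\<in>Q. tail_refines (\<lambda>n. h ` t n) d)"

lemma converges_to_base_mono:
  "converges_to_base N z Q h \<Longrightarrow> Q \<subseteq> Q' \<Longrightarrow> converges_to_base N z Q' h"
  unfolding converges_to_base_def by (elim disjE; simp; meson subsetD)

lemma converges_to_base_cong:
  assumes "converges_to_base N z Q h" "\<And>l. l \<in> L \<Longrightarrow> h l = h' l"
  shows "converges_to_base N z Q h'"
proof -
  have "h ` t n = h' ` t n" if "t \<in> T" for t n
    using tail_subset[OF that] assms(2) by (intro image_cong) auto
  then show ?thesis
    using assms(1) unfolding converges_to_base_def by (simp cong: bex_cong)
qed

text \<open>The requirements on a point to be added. The last conjunct keeps members of
  \<open>T'\<close> from converging to it.\<close>

definition neighbourhood_base ::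
  "'x set \<Rightarrow> (nat \<Rightarrow> 'x set) set \<Rightarrow> (nat \<Rightarrow> 'x set) \<Rightarrow> bool" where
  "neighbourhood_base N T' d \<longleftrightarrow> antimono d \<and> (\<forall>n. d n \<subseteq> N \<and> d n \<noteq> {}) \<and>
     (\<forall>x. \<exists>n. x \<notin> d n) \<and> (\<forall>s\<in>T'. \<not> tail_refines s d)"

lemma extend_bases:
  assumes "h \<in> L \<rightarrow> insert z N" "z \<notin> N" "countable N" "N \<noteq> {}"
    and "countable Q" and Q: "\<And>d. d \<in> Q \<Longrightarrow> neighbourhood_base N T' d"
    and T': "\<And>\<phi>. \<phi> \<in> L \<rightarrow> N \<Longrightarrow> \<exists>t\<in>T. \<forall>s\<in>T'. \<not> tail_refines s (\<lambda>n. \<phi> ` t n)"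
    and no: "\<not> converges_to_base N z Q h"
  shows "\<exists>d. neighbourhood_base N T' d \<and> (\<forall>d'\<in>Q. \<exists>n. d n \<inter> d' n = {}) \<and> converges_to_base N z {d} h"
proof -
  have "\<exists>t\<in>T. h ` t 0 \<subseteq> N \<and> (\<forall>x. \<exists>n. x \<notin> h ` t n) \<and>
      (\<forall>s\<in>T'. \<not> tail_refines s (\<lambda>n. h ` t n)) \<and> (\<forall>d\<in>Q. \<exists>n. h ` t n \<inter> d n = {})"
  proof (rule new_neighbourhood_base)
    show "\<And>d. d \<in> Q \<Longrightarrow> antimono d" using Q by (simp add: neighbourhood_base_def)
    show "\<And>t. t \<in> T \<Longrightarrow> \<not> h ` t 0 \<subseteq> {z}"
      "\<And>t x. t \<in> T \<Longrightarrow> x \<in> N \<Longrightarrow> \<not> h ` t 0 \<subseteq> {x}"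
      "\<And>t d. t \<in> T \<Longrightarrow> d \<in> Q \<Longrightarrow> \<not> tail_refines (\<lambda>n. h ` t n) d"
      using no unfolding converges_to_base_def by meson+
  qed fact+
  then obtain t where t: "t \<in> T" "h ` t 0 \<subseteq> N" "\<forall>x. \<exists>n. x \<notin> h ` t n"
    "\<forall>s\<in>T'. \<not> tail_refines s (\<lambda>n. h ` t n)" "\<forall>d\<in>Q. \<exists>n. h ` t n \<inter> d n = {}"
    by meson
  have "antimono (\<lambda>n. h ` t n)"
    using tail_antimono[OF t(1)] by (intro antimonoI image_mono)
  moreover have "h ` t n \<subseteq> N" "h ` t n \<noteq> {}" for n
    using t(2) tail_antimono[OF t(1), of 0 n] infinite_tail[OF t(1), of n] by auto
  ultimately have "neighbourhood_base N T' (\<lambda>n. h ` t n)"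
    using t unfolding neighbourhood_base_def by simp
  moreover have "tail_refines (\<lambda>n. h ` t n) (\<lambda>n. h ` t n)"
    unfolding tail_refines_def by blast
  then have "converges_to_base N z {\<lambda>n. h ` t n} h"
    using t(1) unfolding converges_to_base_def by simp metis
  ultimately show ?thesis using t(5) by (intro exI[of _ "\<lambda>n. h ` t n"]) simp
qed

text \<open>Stage \<open>i\<close> of the recursion treats the map \<open>h i\<close> and faces only
  countably many earlier bases, as the fusion requires. A stage with value \<open>None\<close> adds
  no point.\<close>

lemma exists_bases:
  fixes N :: "real set"
  assumes CH: continuum_hypothesis and N: "z \<notin> N" "countable N" "N \<noteq> {}"
    and T': "\<And>\<phi>. \<phi> \<in> L \<rightarrow> N \<Longrightarrow> \<exists>t\<in>T. \<forall>s\<in>T'. \<not> tail_refines s (\<lambda>n. \<phi> ` t n)"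
  obtains I :: "real set" and D where "I \<subseteq> {0<..}"
    "\<And>i. i \<in> I \<Longrightarrow> neighbourhood_base N T' (D i)"
    "\<And>i j. i \<in> I \<Longrightarrow> j \<in> I \<Longrightarrow> i \<noteq> j \<Longrightarrow> \<exists>n. D i n \<inter> D j n = {}"
    "\<And>h. h \<in> L \<rightarrow> insert z N \<Longrightarrow> converges_to_base N z (D ` I) h"
proof -
  obtain R :: "(real \<times> real) set" where R: "wf R" "\<And>i. countable {j. (j, i) \<in> R}"
      "\<And>i j. i \<noteq> j \<Longrightarrow> (i, j) \<in> R \<or> (j, i) \<in> R"
    using continuum_hypothesis_countable_initial_segments[OF CH] by metis
  obtain h :: "real \<Rightarrow> 'a \<Rightarrow> real" where h: "\<And>i. h i \<in> L \<rightarrow> insert z N"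
      "\<And>f. f \<in> L \<rightarrow> insert z N \<Longrightarrow> \<exists>i>0. \<forall>a\<in>L. h i a = f a"
    using enumerate_functions_by_positive_reals[OF countable_base, of "insert z N"] N(2)
    by (metis countable_insert insert_not_empty)
  define old where "old f i = {d. \<exists>j. (j, i) \<in> R \<and> f j = Some d}"
    for f :: "real \<Rightarrow> (nat \<Rightarrow> real set) option" and i
  \<comment> \<open>Nonpositive stages are forced to add nothing, which places all added points
    among the positive reals. Disjointness is demanded from earlier bases only; totality of
    \<open>R\<close> extends it to all pairs.\<close>
  define P where "P f i r \<longleftrightarrow> (i \<le> 0 \<longrightarrow> r = None) \<and>
      (i > 0 \<longrightarrow> converges_to_base N z (old f i \<union> set_option r) (h i)) \<and>
      (\<forall>d. r = Some d \<longrightarrow> neighbourhood_base N T' d \<and> (\<forall>d'\<in>old f i. \<exists>n. d n \<inter> d' n = {}))" for f i r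
  have "\<exists>f. \<forall>i. P f i (f i)"
  proof (rule dependent_wf_choice[OF R(1)])
    fix f g :: "real \<Rightarrow> (nat \<Rightarrow> real set) option" and i r
    assume "\<And>j. (j, i) \<in> R \<Longrightarrow> f j = g j"
    then have "old f i = old g i" unfolding old_def by (metis (lifting))
    then show "P f i r = P g i r" unfolding P_def by simp
  next
    fix i f assume prev: "\<And>j. (j, i) \<in> R \<Longrightarrow> P f j (f j)"
    have "old f i \<subseteq> (\<lambda>j. the (f j)) ` {j. (j, i) \<in> R}" unfolding old_def by force
    then have "countable (old f i)" using R(2) by (meson countable_image countable_subset)
    have base: "neighbourhood_base N T' d" if "d \<in> old f i" for d
      using that prev unfolding old_def P_def by blast
    consider "i \<le> 0" | "i > 0" "converges_to_base N z (old f i) (h i)"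
      | "i > 0" "\<not> converges_to_base N z (old f i) (h i)" by linarith
    then show "\<exists>r. P f i r"
    proof cases
      case 1
      then have "P f i None" by (simp add: P_def)
      then show ?thesis ..
    next
      case 2
      then have "P f i None" by (simp add: P_def)
      then show ?thesis ..
    next
      case 3
      obtain d where d: "neighbourhood_base N T' d" "\<forall>d'\<in>old f i. \<exists>n. d n \<inter> d' n = {}"
          "converges_to_base N z {d} (h i)"
        using extend_bases[OF h(1) N \<open>countable (old f i)\<close> base T' 3(2)] by metis
      have "converges_to_base N z (old f i \<union> {d}) (h i)"
        using d(3) by (rule converges_to_base_mono) simp
      then have "P f i (Some d)" using d 3(1) by (simp add: P_def)
      then show ?thesis ..
    qed
  qed
  then obtain f where f: "\<And>i. P f i (f i)" by blast
  define I where "I = {i. f i \<noteq> None}"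
  define D where "D i = the (f i)" for i
  have fD: "f i = Some (D i)" if "i \<in> I" for i
    using that by (auto simp: I_def D_def)
  show thesis
  proof (rule that)
    show "I \<subseteq> {0<..}"
    proof
      fix i assume "i \<in> I"
      then show "i \<in> {0<..}" using f[of i] by (simp add: P_def fD not_le[symmetric])
    qed
    show "neighbourhood_base N T' (D i)" if "i \<in> I" for i
      using f[of i] fD[OF that] by (simp add: P_def)
    show "\<exists>n. D i n \<inter> D j n = {}" if ij: "i \<in> I" "j \<in> I" "i \<noteq> j" for i j
    proof -
      have *: "\<exists>n. D i n \<inter> D j n = {}" if "i \<in> I" "j \<in> I" "(j, i) \<in> R" for i j
      proof -
        have "D j \<in> old f i" using that fD[of j] by (auto simp: old_def)
        then show ?thesis using f[of i] fD[OF that(1)] by (simp add: P_def)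
      qed
      from R(3)[OF ij(3)] show ?thesis
        using *[OF ij(1,2)] *[OF ij(2,1)] by (auto simp: Int_commute)
    qed
    show "converges_to_base N z (D ` I) g" if g: "g \<in> L \<rightarrow> insert z N" for g
    proof -
      obtain i where i: "i > 0" "\<And>a. a \<in> L \<Longrightarrow> h i a = g a" using h(2)[OF g] by blast
      have "converges_to_base N z (old f i \<union> set_option (f i)) (h i)"
        using f[of i] i(1) by (simp add: P_def)
      moreover have "old f i \<union> set_option (f i) \<subseteq> D ` I"
      proof
        fix d assume "d \<in> old f i \<union> set_option (f i)"
        then obtain j where j: "f j = Some d" by (auto simp: old_def)
        then have "j \<in> I" by (simp add: I_def)
        with j fD show "d \<in> D ` I" by force
      qed
      ultimately have "converges_to_base N z (D ` I) (h i)" by (rule converges_to_base_mono)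
      then show ?thesis by (rule converges_to_base_cong) (rule i(2))
    qed
  qed
qed

text \<open>The negative reals contain \<open>N\<close>, the number 0 is the point at infinity, and
  the added points are positive. A map \<open>f\<close> into the space is reduced to a map
  \<open>h\<close> into \<open>insert 0 N\<close> by hiding all values outside
  \<open>N\<close>.\<close>

lemma exists_space:
  fixes N :: "real set"
  assumes CH: continuum_hypothesis and N: "N \<subseteq> {..<0}" "countable N" "N \<noteq> {}"
    and T'_seq: "\<And>s. s \<in> T' \<Longrightarrow> antimono s \<and> (\<forall>n. s n \<subseteq> N \<and> infinite (s n))"
    and T': "\<And>\<phi>. \<phi> \<in> L \<rightarrow> N \<Longrightarrow> \<exists>t\<in>T. \<forall>s\<in>T'. \<not> tail_refines s (\<lambda>n. \<phi> ` t n)"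
  obtains X :: "real topology" where "separable_space X" "unique_sequential_limits X" "N \<subseteq> topspace X"
    "\<forall>f \<in> L \<rightarrow> topspace X. \<exists>t\<in>T. \<exists>x\<in>topspace X.
       \<forall>U. openin X U \<and> x \<in> U \<longrightarrow> (\<exists>n. f ` t n \<subseteq> U)"
    "\<forall>s\<in>T'. \<forall>x\<in>topspace X. \<exists>U. openin X U \<and> x \<in> U \<and> (\<forall>n. \<not> s n \<subseteq> U)"
proof -
  have T'_sub: "s n \<subseteq> N" and T'_inf: "infinite (s n)" if "s \<in> T'" for s n
    using T'_seq[OF that] by auto
  have T'_anti: "s n \<subseteq> s m" if "s \<in> T'" "m \<le> n" for s m n
    using T'_seq[OF that(1)] that(2) by (auto dest: antimonoD)
  have "0 \<notin> N" using N(1) by auto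
  then obtain I :: "real set" and D where I: "I \<subseteq> {0<..}"
    and base: "\<And>i. i \<in> I \<Longrightarrow> neighbourhood_base N T' (D i)"
    and disj: "\<And>i j. i \<in> I \<Longrightarrow> j \<in> I \<Longrightarrow> i \<noteq> j \<Longrightarrow> \<exists>n. D i n \<inter> D j n = {}"
    and conv: "\<And>h. h \<in> L \<rightarrow> insert 0 N \<Longrightarrow> converges_to_base N 0 (D ` I) h"
    using exists_bases[OF CH _ N(2,3) T'] by metis
  interpret X: limit_points_space N I 0 D "limit_points_topology N I 0 D"
  proof
    show "N \<inter> I = {}" "0 \<notin> I" using N(1) I by force+
  qed (use N \<open>0 \<notin> N\<close> base disj in \<open>auto simp: neighbourhood_base_def\<close>)
  let ?X = "limit_points_topology N I 0 D"
  have const: "\<exists>t\<in>T. \<exists>x\<in>topspace ?X. \<forall>U. openin ?X U \<and> x \<in> U \<longrightarrow> (\<exists>n. f ` t n \<subseteq> U)"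
    if t: "t \<in> T" "f ` t 0 \<subseteq> {x}" "f \<in> L \<rightarrow> topspace ?X" for f t x
  proof -
    obtain l where l: "l \<in> t 0" using infinite_tail[OF t(1), of 0] by fastforce
    then have "x = f l" "l \<in> L" using t(2) tail_subset[OF t(1)] by blast+
    then have "x \<in> topspace ?X" using t(3) by blast
    moreover have "\<exists>n. f ` t n \<subseteq> U" if "openin ?X U \<and> x \<in> U" for U
      using t(2) that by (intro exI[of _ 0]) blast
    ultimately show ?thesis using t(1) by (intro bexI[of _ t] bexI[of _ x]) auto
  qed
  have FinBW: "\<exists>t\<in>T. \<exists>x\<in>topspace ?X. \<forall>U. openin ?X U \<and> x \<in> U \<longrightarrow> (\<exists>n. f ` t n \<subseteq> U)"
    if f: "f \<in> L \<rightarrow> topspace ?X" for f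
  proof -
    define h where "h l = (if f l \<in> N then f l else 0)" for l
    have "h \<in> L \<rightarrow> insert 0 N" by (auto simp: h_def)
    from conv[OF this] consider t where "t \<in> T" "h ` t 0 \<subseteq> {0}"
      | t x where "t \<in> T" "x \<in> N" "h ` t 0 \<subseteq> {x}"
      | t i where "t \<in> T" "i \<in> I" "tail_refines (\<lambda>n. h ` t n) (D i)"
      unfolding converges_to_base_def by blast
    then show ?thesis
    proof cases
      case 1
      \<comment> \<open>Along \<open>t\<close> all values of \<open>f\<close> are infinity or added
        points. Either \<open>f\<close> is constant somewhere, or some tail leaves the finite part
        of \<open>I\<close> that a neighbourhood of 0 may miss.\<close>
      have off_N: "f l \<in> insert 0 I" if "l \<in> t 0" for l
      proof -
        have "h l = 0" using 1(2) that by blast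
        then have "f l \<notin> N" using \<open>0 \<notin> N\<close> by (auto simp: h_def split: if_splits)
        moreover have "f l \<in> insert 0 (N \<union> I)"
          using f that tail_subset[OF 1(1)] unfolding X.topspace_eq by blast
        ultimately show ?thesis by blast
      qed
      from constant_or_finite_to_one[OF 1(1), of f] show ?thesis
      proof
        assume "\<exists>u\<in>T. \<exists>x. u 0 \<subseteq> t 0 \<and> f ` u 0 \<subseteq> {x}"
        then show ?thesis using const f by meson
      next
        assume "\<exists>v\<in>T. v 0 \<subseteq> t 0 \<and> (\<forall>x. \<exists>m. x \<notin> f ` v m)"
        then obtain v where v: "v \<in> T" "v 0 \<subseteq> t 0" "\<And>x. \<exists>m. x \<notin> f ` v m" by blast
        have "\<exists>n. f ` v n \<subseteq> U" if U: "openin ?X U" "0 \<in> U" for U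
        proof -
          have "finite (I - U)" using U unfolding X.openin_iff by blast
          moreover have "\<exists>n. f ` v n \<inter> C = {}" if "finite C" for C
            using that
          proof induction
            case (insert x C)
            obtain n where n: "f ` v n \<inter> C = {}" using insert.IH by blast
            obtain m where m: "x \<notin> f ` v m" using v(3) by blast
            have "v (max m n) \<subseteq> v m" "v (max m n) \<subseteq> v n"
              using tail_antimono[OF v(1)] by simp_all
            then have "f ` v (max m n) \<inter> insert x C = {}" using m n by blast
            then show ?case ..
          qed simp
          ultimately obtain n where n: "f ` v n \<inter> (I - U) = {}" by blast
          have "v n \<subseteq> t 0" using tail_antimono[OF v(1), of 0 n] v(2) by blast
          have "f ` v n \<subseteq> U"
          proof
            fix y assume y: "y \<in> f ` v n"
            then have "y \<in> insert 0 I" using \<open>v n \<subseteq> t 0\<close> off_N by blast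
            moreover have "y \<notin> I - U" using n y by blast
            ultimately show "y \<in> U" using U(2) by blast
          qed
          then show ?thesis ..
        qed
        moreover have "0 \<in> topspace ?X" by (simp add: X.topspace_eq)
        ultimately show ?thesis using v(1) by (intro bexI[of _ v] bexI[of _ 0]) auto
      qed
    next
      case 2
      have "f ` t 0 \<subseteq> {x}"
      proof
        fix y assume "y \<in> f ` t 0"
        then obtain l where l: "l \<in> t 0" "y = f l" by blast
        then have "h l = x" using 2(3) by blast
        with \<open>0 \<notin> N\<close> 2(2) l(2) show "y \<in> {x}" by (auto simp: h_def split: if_splits)
      qed
      with 2(1) f show ?thesis by (intro const)
    next
      case 3
      \<comment> \<open>The sets \<open>D i n\<close> lie in \<open>N\<close>, so where
        \<open>h\<close> takes values in them nothing was hidden and \<open>h\<close> agrees with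
        \<open>f\<close>.\<close>
      have "\<exists>m. f ` t m \<subseteq> U" if U: "openin ?X U" "i \<in> U" for U
      proof -
        obtain n where n: "D i n \<subseteq> U" using U 3(2) unfolding X.openin_iff by blast
        obtain m where m: "h ` t m \<subseteq> D i n" using 3(3) unfolding tail_refines_def by blast
        have "f ` t m \<subseteq> U"
        proof
          fix y assume "y \<in> f ` t m"
          then obtain l where l: "l \<in> t m" "y = f l" by blast
          then have "h l \<in> D i n" using m by blast
          moreover from this have "h l \<in> N" using X.D_subset[OF 3(2)] by blast
          then have "h l = f l" using \<open>0 \<notin> N\<close> by (auto simp: h_def split: if_splits)
          ultimately show "y \<in> U" using n l(2) by auto
        qed
        then show ?thesis ..
      qed
      moreover have "i \<in> topspace ?X" using 3(2) by (simp add: X.topspace_eq)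
      ultimately show ?thesis using 3(1) by (intro bexI[of _ t] bexI[of _ i]) auto
    qed
  qed
  have not_FinBW: "\<exists>U. openin ?X U \<and> x \<in> U \<and> (\<forall>n. \<not> s n \<subseteq> U)"
    if s: "s \<in> T'" and x: "x \<in> topspace ?X" for s x
  proof -
    consider "x \<in> N" | "x \<in> I" | "x = 0" using x unfolding X.topspace_eq by blast
    then show ?thesis
    proof cases
      case 1
      have "\<not> s n \<subseteq> {x}" for n using T'_inf[OF s, of n] finite_subset by auto
      then show ?thesis using X.openin_isolated[OF 1] by blast
    next
      case 2
      then have "\<not> tail_refines s (D x)" using base s by (simp add: neighbourhood_base_def)
      then obtain n where n: "\<And>m. \<not> s m \<subseteq> D x n" unfolding tail_refines_def by blast
      have "x \<notin> N" using 2 X.disjoint by blast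
      then have "\<not> s m \<subseteq> insert x (D x n)" for m
        using n[of m] T'_sub[OF s, of m] by blast
      then show ?thesis using X.openin_basic[OF 2, of n] by blast
    next
      case 3
      \<comment> \<open>An injective sequence through the sets \<open>s n\<close> is transported to
        \<open>L\<close> as an injective map \<open>h\<close>. It is constant on no
        \<open>t 0\<close>, so by construction it converges along some \<open>t\<close> to an added
        point \<open>i\<close>.\<close>
      obtain b where b: "inj b" "\<And>n. b n \<in> s n" using injective_choice[of s] T'_inf[OF s] by blast
      define h where "h l = b (to_nat_on L l)" for l
      have h_inj: "inj_on h L"
        unfolding h_def using b(1) countable_base
        by (intro inj_onI) (simp add: inj_eq)
      have bN: "b n \<in> N" for n using b(2) T'_sub[OF s] by blast
      have h_inf: "infinite (h ` t n)" if "t \<in> T" for t n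
        using infinite_tail[OF that] tail_subset[OF that] h_inj
        by (meson finite_image_iff inj_on_subset)
      have "h \<in> L \<rightarrow> insert 0 N" using bN by (simp add: h_def)
      moreover have "\<not> h ` t 0 \<subseteq> {x}" if "t \<in> T" for t x
        using h_inf[OF that, of 0] finite_subset[of "h ` t 0" "{x}"] by blast
      ultimately have "\<exists>t\<in>T. \<exists>i\<in>I. tail_refines (\<lambda>n. h ` t n) (D i)"
        using conv[of h] unfolding converges_to_base_def by simp
      then obtain t i where t: "t \<in> T" "i \<in> I" "tail_refines (\<lambda>n. h ` t n) (D i)" by blast
      have "infinite (range b \<inter> D i n)" for n
      proof -
        obtain m where "h ` t m \<subseteq> D i n" using t(3) unfolding tail_refines_def by blast
        moreover have "h ` t m \<subseteq> range b" unfolding h_def by blast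
        ultimately show ?thesis using h_inf[OF t(1), of m] finite_subset[of "h ` t m" "range b \<inter> D i n"] by blast
      qed
      \<comment> \<open>The range of \<open>c\<close> is an infinite part of \<open>range b\<close>
        converging to \<open>i\<close>; deleting it together with \<open>i\<close> leaves a
        neighbourhood of infinity.\<close>
      then obtain c where c: "inj c" "\<And>n. c n \<in> range b \<inter> D i n"
        using injective_choice[of "\<lambda>n. range b \<inter> D i n"] by blast
      have "finite (range c - D i n)" for n
      proof (rule finite_subset)
        show "range c - D i n \<subseteq> c ` {..<n}"
        proof
          fix y assume "y \<in> range c - D i n"
          then obtain k where k: "y = c k" "c k \<notin> D i n" by blast
          have "\<not> n \<le> k" using X.D_mono[OF t(2), of n k] c(2)[of k] k(2) by blast
          with k(1) show "y \<in> c ` {..<n}" by simp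
        qed
      qed simp
      moreover have cN: "range c \<subseteq> N" using c(2) X.D_subset[OF t(2)] by blast
      ultimately have op: "openin ?X (topspace ?X - insert i (range c))"
        using X.openin_diff_convergent[OF t(2)] by blast
      \<comment> \<open>All \<open>b k\<close> with \<open>k \<ge> n\<close> lie in
        \<open>s n\<close>, so an \<open>s n\<close> missing \<open>range c\<close> would leave only
        finitely many values for the injective \<open>c\<close>.\<close>
      have "\<not> s n \<subseteq> topspace ?X - insert i (range c)" for n
      proof
        assume sn: "s n \<subseteq> topspace ?X - insert i (range c)"
        have "range c \<subseteq> b ` {..<n}"
        proof
          fix y assume y: "y \<in> range c"
          then obtain k where k: "y = b k" using c(2) by blast
          have "\<not> n \<le> k"
          proof
            assume "n \<le> k"
            then have "y \<in> s n" using T'_anti[OF s, of n k] b(2)[of k] k by auto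
            with sn y show False by blast
          qed
          with k show "y \<in> b ` {..<n}" by simp
        qed
        then have "finite (range c)" by (rule finite_subset) simp
        with c(1) show False by (simp add: finite_image_iff)
      qed
      moreover have "0 \<in> topspace ?X - insert i (range c)"
        using cN \<open>0 \<notin> N\<close> t(2) X.disjoint by (auto simp: X.topspace_eq)
      ultimately show ?thesis using op 3 by blast
    qed
  qed
  show thesis
  proof (rule that)
    show "separable_space ?X" by (rule X.separable)
    show "unique_sequential_limits ?X" by (rule X.unique_limits)
    show "N \<subseteq> topspace ?X" by (auto simp: X.topspace_eq)
  qed (intro ballI, erule FinBW, intro ballI, erule (1) not_FinBW)
qed

end

section \<open>Transfer back to the two partition regular functions\<close>

theorem theorem17p2:
  fixes \<Lambda>\<^sub>1 :: "'l1 set" and \<Omega>\<^sub>1 :: "'o1 set" and \<F>\<^sub>1 :: "'o1 set set"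
    and \<rho>\<^sub>1 :: "'o1 set \<Rightarrow> 'l1 set"
    and \<Lambda>\<^sub>2 :: "'l2 set" and \<Omega>\<^sub>2 :: "'o2 set" and \<F>\<^sub>2 :: "'o2 set set"
    and \<rho>\<^sub>2 :: "'o2 set \<Rightarrow> 'l2 set"
  assumes "continuum_hypothesis"
    and "partition_regular \<Lambda>\<^sub>1 \<Omega>\<^sub>1 \<F>\<^sub>1 \<rho>\<^sub>1"
    and "partition_regular \<Lambda>\<^sub>2 \<Omega>\<^sub>2 \<F>\<^sub>2 \<rho>\<^sub>2"
    and "weak_P_plus \<Omega>\<^sub>1 \<F>\<^sub>1 \<rho>\<^sub>1"
    and "has_small_accretions \<Lambda>\<^sub>1 \<Omega>\<^sub>1 \<F>\<^sub>1 \<rho>\<^sub>1"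
  shows
    "(\<not> katetov_le \<Lambda>\<^sub>2 \<Omega>\<^sub>2 \<F>\<^sub>2 \<rho>\<^sub>2 \<Lambda>\<^sub>1 \<Omega>\<^sub>1 \<F>\<^sub>1 \<rho>\<^sub>1 \<longleftrightarrow>
        (\<exists>X :: real topology. separable_space X \<and> unique_sequential_limits X \<and>
           X \<in> FinBW \<Lambda>\<^sub>1 \<Omega>\<^sub>1 \<F>\<^sub>1 \<rho>\<^sub>1 - FinBW \<Lambda>\<^sub>2 \<Omega>\<^sub>2 \<F>\<^sub>2 \<rho>\<^sub>2)) \<and>
     ((\<exists>X :: 'x topology. separable_space X \<and> unique_sequential_limits X \<and>
           X \<in> FinBW \<Lambda>\<^sub>1 \<Omega>\<^sub>1 \<F>\<^sub>1 \<rho>\<^sub>1 - FinBW \<Lambda>\<^sub>2 \<Omega>\<^sub>2 \<F>\<^sub>2 \<rho>\<^sub>2) \<longrightarrow>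
        \<not> katetov_le \<Lambda>\<^sub>2 \<Omega>\<^sub>2 \<F>\<^sub>2 \<rho>\<^sub>2 \<Lambda>\<^sub>1 \<Omega>\<^sub>1 \<F>\<^sub>1 \<rho>\<^sub>1)"
proof -
  have "\<exists>X :: real topology. separable_space X \<and> unique_sequential_limits X \<and>
      X \<in> FinBW \<Lambda>\<^sub>1 \<Omega>\<^sub>1 \<F>\<^sub>1 \<rho>\<^sub>1 - FinBW \<Lambda>\<^sub>2 \<Omega>\<^sub>2 \<F>\<^sub>2 \<rho>\<^sub>2"
    if nle: "\<not> katetov_le \<Lambda>\<^sub>2 \<Omega>\<^sub>2 \<F>\<^sub>2 \<rho>\<^sub>2 \<Lambda>\<^sub>1 \<Omega>\<^sub>1 \<F>\<^sub>1 \<rho>\<^sub>1"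
  proof -
    let ?T\<^sub>1 = "tail \<Omega>\<^sub>1 \<rho>\<^sub>1 ` \<F>\<^sub>1" and ?T\<^sub>2 = "tail \<Omega>\<^sub>2 \<rho>\<^sub>2 ` \<F>\<^sub>2"
    interpret T\<^sub>1: diagonal_tail_family \<Lambda>\<^sub>1 ?T\<^sub>1
      by (rule diagonal_tail_family_tails) fact+
    interpret T\<^sub>2: tail_family \<Lambda>\<^sub>2 ?T\<^sub>2
      by (rule tail_family_tails) fact
    \<comment> \<open>\<open>\<Lambda>\<^sub>2\<close> is copied into the negative reals; the shift
      by one keeps 0 free for the point at infinity.\<close>
    define e where "e y = - 1 - real (to_nat_on \<Lambda>\<^sub>2 y)" for y
    have e_inj: "inj_on e \<Lambda>\<^sub>2"
      using T\<^sub>2.countable_base by (intro inj_onI) (simp add: e_def)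
    define N where "N = e ` \<Lambda>\<^sub>2"
    define T' where "T' = (\<lambda>s n. e ` s n) ` ?T\<^sub>2"
    have T': "\<exists>t\<in>?T\<^sub>1. \<forall>s\<in>T'. \<not> tail_refines s (\<lambda>n. \<phi> ` t n)" if \<phi>: "\<phi> \<in> \<Lambda>\<^sub>1 \<rightarrow> N" for \<phi>
    proof -
      \<comment> \<open>Pulled back along \<open>e\<close>, the map \<open>\<phi>\<close> becomes a
        map into \<open>\<Lambda>\<^sub>2\<close>, which is not a Katetov reduction; injectivity of
        \<open>e\<close> carries this failure back to \<open>\<phi>\<close>.\<close>
      define \<psi> where "\<psi> l = inv_into \<Lambda>\<^sub>2 e (\<phi> l)" for l
      have \<psi>: "\<psi> l \<in> \<Lambda>\<^sub>2" "e (\<psi> l) = \<phi> l" if "l \<in> \<Lambda>\<^sub>1" for l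
        using inv_into_into[of "\<phi> l" e \<Lambda>\<^sub>2] f_inv_into_f[of "\<phi> l" e \<Lambda>\<^sub>2] \<phi> that
        unfolding \<psi>_def N_def by blast+
      then have "\<psi> \<in> \<Lambda>\<^sub>1 \<rightarrow> \<Lambda>\<^sub>2" by blast
      then obtain t where t: "t \<in> ?T\<^sub>1" "\<And>s. s \<in> ?T\<^sub>2 \<Longrightarrow> \<not> tail_refines s (\<lambda>n. \<psi> ` t n)"
        using nle unfolding katetov_le_iff_tail[OF assms(2,3)] by meson
      have "\<not> tail_refines (\<lambda>n. e ` s n) (\<lambda>n. \<phi> ` t n)" if s: "s \<in> ?T\<^sub>2" for s
      proof
        assume ref: "tail_refines (\<lambda>n. e ` s n) (\<lambda>n. \<phi> ` t n)"
        have "tail_refines s (\<lambda>n. \<psi> ` t n)"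
          unfolding tail_refines_def
        proof
          fix n
          obtain m where m: "e ` s m \<subseteq> \<phi> ` t n" using ref unfolding tail_refines_def by blast
          have "\<phi> ` t n = e ` \<psi> ` t n"
            unfolding image_image using \<psi>(2) T\<^sub>1.tail_subset[OF t(1), of n]
            by (intro image_cong) auto
          moreover have "\<psi> ` t n \<subseteq> \<Lambda>\<^sub>2" using \<psi>(1) T\<^sub>1.tail_subset[OF t(1), of n] by blast
          ultimately have "s m \<subseteq> \<psi> ` t n"
            using m inj_on_image_subset_iff[OF e_inj T\<^sub>2.tail_subset[OF s]] by simp
          then show "\<exists>m. s m \<subseteq> \<psi> ` t n" ..
        qed
        with t(2) s show False by blast
      qed
      with t(1) show ?thesis unfolding T'_def by blast
    qed
    have N: "N \<subseteq> {..<0}" by (auto simp: N_def e_def)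
    have N_ctbl: "countable N" unfolding N_def using T\<^sub>2.countable_base by simp
    have N_ne: "N \<noteq> {}" unfolding N_def using T\<^sub>2.infinite_base by auto
    have T'_seq: "antimono s \<and> (\<forall>n. s n \<subseteq> N \<and> infinite (s n))" if "s \<in> T'" for s
    proof -
      from that obtain s' where s': "s' \<in> ?T\<^sub>2" "s = (\<lambda>n. e ` s' n)" unfolding T'_def by blast
      have "infinite (s n)" for n
      proof -
        have "inj_on e (s' n)" using e_inj T\<^sub>2.tail_subset[OF s'(1)] by (rule inj_on_subset)
        then show ?thesis using T\<^sub>2.infinite_tail[OF s'(1), of n] s'(2) by (simp add: finite_image_iff)
      qed
      moreover have "s n \<subseteq> N" for n
        using T\<^sub>2.tail_subset[OF s'(1), of n] unfolding s'(2) N_def by blast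
      moreover have "antimono s"
        unfolding s'(2) using T\<^sub>2.tail_antimono[OF s'(1)] by (intro antimonoI image_mono)
      ultimately show ?thesis by blast
    qed
    obtain X :: "real topology" where X: "separable_space X" "unique_sequential_limits X"
        "N \<subseteq> topspace X"
      and FinBW\<^sub>1: "\<forall>f \<in> \<Lambda>\<^sub>1 \<rightarrow> topspace X. \<exists>t\<in>?T\<^sub>1. \<exists>x\<in>topspace X.
        \<forall>U. openin X U \<and> x \<in> U \<longrightarrow> (\<exists>n. f ` t n \<subseteq> U)"
      and FinBW\<^sub>2: "\<forall>s\<in>T'. \<forall>x\<in>topspace X.
        \<exists>U. openin X U \<and> x \<in> U \<and> (\<forall>n. \<not> s n \<subseteq> U)"
      by (rule T\<^sub>1.exists_space[OF assms(1) N N_ctbl N_ne T'_seq T'])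
    have "X \<in> FinBW \<Lambda>\<^sub>1 \<Omega>\<^sub>1 \<F>\<^sub>1 \<rho>\<^sub>1"
      unfolding FinBW_iff_tail[OF assms(2)] by (rule FinBW\<^sub>1)
    \<comment> \<open>The embedding \<open>e\<close> itself is the counterexample: a convergent
      restriction would make a member of \<open>T'\<close> converge to a point of
      \<open>X\<close>.\<close>
    moreover have "X \<notin> FinBW \<Lambda>\<^sub>2 \<Omega>\<^sub>2 \<F>\<^sub>2 \<rho>\<^sub>2"
    proof
      assume "X \<in> FinBW \<Lambda>\<^sub>2 \<Omega>\<^sub>2 \<F>\<^sub>2 \<rho>\<^sub>2"
      moreover have "e \<in> \<Lambda>\<^sub>2 \<rightarrow> topspace X" using X(3) by (auto simp: N_def)
      ultimately obtain s x where s: "s \<in> ?T\<^sub>2" "x \<in> topspace X"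
          "\<And>U. openin X U \<Longrightarrow> x \<in> U \<Longrightarrow> \<exists>n. e ` s n \<subseteq> U"
        unfolding FinBW_iff_tail[OF assms(3)] by meson
      have "(\<lambda>n. e ` s n) \<in> T'" using s(1) unfolding T'_def by blast
      then show False using FinBW\<^sub>2 s(2,3) by meson
    qed
    ultimately show ?thesis using X by blast
  qed
  \<comment> \<open>Reducibility gives the inclusion of the \<open>FinBW\<close> classes over any
    point type, so it is instantiated both at the reals and at the arbitrary type
    \<open>'x\<close>.\<close>
  moreover have "FinBW \<Lambda>\<^sub>1 \<Omega>\<^sub>1 \<F>\<^sub>1 \<rho>\<^sub>1 \<subseteq> (FinBW \<Lambda>\<^sub>2 \<Omega>\<^sub>2 \<F>\<^sub>2 \<rho>\<^sub>2 :: real topology set)"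
    "FinBW \<Lambda>\<^sub>1 \<Omega>\<^sub>1 \<F>\<^sub>1 \<rho>\<^sub>1 \<subseteq> (FinBW \<Lambda>\<^sub>2 \<Omega>\<^sub>2 \<F>\<^sub>2 \<rho>\<^sub>2 :: 'x topology set)"
    if "katetov_le \<Lambda>\<^sub>2 \<Omega>\<^sub>2 \<F>\<^sub>2 \<rho>\<^sub>2 \<Lambda>\<^sub>1 \<Omega>\<^sub>1 \<F>\<^sub>1 \<rho>\<^sub>1"
    using katetov_le_FinBW_subset[OF assms(2,3) that] by blast+
  ultimately show ?thesis by blast
qed

end
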